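(* Let $(X,\ll,\leq,\mathfrak T)$ be a topological causal space and let $(H,G,\mathfrak m)$ be a synthetic null hypersurface in $X$ such that $H$ is null non-branching and $(H,G,\mathfrak m)$ satisfies the Null Energy Condition $\mathsf{NC}^e(N)$ for some $N>1$. Then $$\mathfrak m(\mathfrak a(H))=\mathfrak m(\mathfrak b(H))=0,$$ where $\mathfrak a(H)$ and $\mathfrak b(H)$ are the sets of initial and final points of $H$.
   Context: A causal space $(X,\ll,\le)$ is a set $X$ with a preorder $\le$ and a transitive relation $\ll$ contained in $\le$. A topological causal space $(X,\ll,\leq,\mathfrak T)$ is a causal space with a Polish topology $\mathfrak T$ induced by a separable proper metric (closed balls are compact), such that $J:=\{(x,y):x\le y\}$ is closed and $\{(x,y):x\ll y\}$ is open in $X\times X$. A set $H$ is achronal if no $x,y\in H$ satisfy $x\ll y$. A causal curve is a continuous $\gamma:I\to X$ ($I$ an interval) with $\gamma_s\le\gamma_t$ for all $s\le t$ (constant curves allowed). For a closed achronal set $H$: $\mathfrak a(H)=\{m\in H:\nexists x\in H,\ x\le m,\ x\ne m\}$; $\mathfrak b(H)=\{m\in H:\nexists x\in H,\ m\le x,\ x\neq m\}$; $\mathfrak s(H)=\mathfrak a(H)\cap\mathfrak b(H)$; $H^\circ=H\setminus(\mathfrak a(H)\cup\mathfrak b(H))$. $H$ is forward null non-branching if for every pair of injective causal curves $\gamma^1,\gamma^2:[0,1]\to H$ with $\gamma^1_0=\gamma^2_0$ and $\gamma^1_{1/2}=\gamma^2_{1/2}$, either $\gamma^1([0,1])\subset\gamma^2([0,1])$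 or $\gamma^2([0,1])\subset\gamma^1([0,1])$; backward null non-branching if it is forward null non-branching for the reversed causal relations; null non-branching if both. A gauge for $H$ is a Borel map $G:H^\circ\to\mathbb R$ such that (1) for any injective causal curve $\gamma$ in $H^\circ$, $G\circ\gamma$ is strictly increasing and continuous; (2) for any causal $\gamma:[0,1]\to H$ with $\gamma((0,1))\subset H^\circ$, $\sup_{(0,1)}G\circ\gamma$ and $\inf_{(0,1)}G\circ\gamma$ are finite. A curve $\gamma:[0,1]\to H$ is $G$-causal if it is constant, or it is causal with $\gamma((0,1))\subset H^\circ$ and $G\circ\gamma|_{(0,1)}$ affine. $\mathrm{Caus}_G\subset C([0,1];H)$ is the set of $G$-causal curves. A synthetic null hypersurface is a triple $(H,G,\mathfrak m)$ with $H$ closed achronal, $G$ a gauge, and $\mathfrak m$ a non-negative Radon measure on $H$ with $\mathfrak m(\mathfrak s(H))=0$. $\Pi_\le(\mu_0,\mu_1)$ is the set of couplings $\pi$ of $\mu_0,\mu_1$ with $\pi(J)=1$. $\mathrm{OptGeo}^G(\mu_0,\mu_1)$ is the set of Borel probability measures $\nu$ on $C([0,1];H)$ with $(e_i)_\sharp\nu=\mu_i$, $i=0,1$ ($e_t$ evaluation at $t$), and $\nu(\mathrm{Caus}_G)=1$. $\mathrm{Ent}(\mu|\mathfrak m)=\int\rho\log\rho\,d\mathfrak m\in[-\infty,\infty)$ if $\mu=\rho\mathfrak m$ and $(\rho\log\rho)_+\in L^1(\mathfrak m)$, and $+\infty$ otherwise. $\mathrm U_{N-1}(\mu|\mathfrak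 m)=\exp(-\mathrm{Ent}(\mu|\mathfrak m)/(N-1))$ (equal to $0$ if $\mathrm{Ent}=+\infty$). $(H,G,\mathfrak m)$ satisfies $\mathsf{NC}^e(N)$ if for all Borel probability measures $\mu_0,\mu_1$ on $H$ with $\Pi_\le(\mu_0,\mu_1)\neq\emptyset$ there is $\nu\in\mathrm{OptGeo}^G(\mu_0,\mu_1)$ such that, with $\mu_t=(e_t)_\sharp\nu$, for all $t\in[0,1]$: $\mathrm U_{N-1}(\mu_t|\mathfrak m)\ge(1-t)\mathrm U_{N-1}(\mu_0|\mathfrak m)+t\,\mathrm U_{N-1}(\mu_1|\mathfrak m)$. *)

theory Defs
  imports "HOL-Probability.Probability"
begin

locale causal_space =
  fixes chron :: "'a \<Rightarrow> 'a \<Rightarrow> bool" and leq :: "'a \<Rightarrow> 'a \<Rightarrow> bool"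
  assumes leq_refl: "reflp leq"
    and leq_trans: "transp leq"
    and chron_trans: "transp chron"
    and chron_imp_leq: "chron x y \<Longrightarrow> leq x y"

text \<open>The space is a whole type, and the metric of the type class is a proper metric inducing the
  given Polish topology. Everything below depends on that metric only through its topology: the
  topology of uniform convergence on \<open>C([0,1]; H)\<close> is the compact-open topology.\<close>

locale topological_causal_space = causal_space chron leq
  for chron leq :: "'a::polish_space \<Rightarrow> 'a \<Rightarrow> bool" +
  assumes proper: "compact (cball (x :: 'a) r)"
    and closed_leq: "closed {(x, y). leq x y}"
    and open_chron: "open {(x, y). chron x y}"

definition achronal :: "('a \<Rightarrow> 'a \<Rightarrow> bool) \<Rightarrow> 'a set \<Rightarrow> bool" where
  "achronal chron H \<longleftrightarrow> (\<nexists>x y. x \<in> H \<and> y \<in> H \<and> chron x y)"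

definition causal_curve_on ::
  "('a::topological_space \<Rightarrow> 'a \<Rightarrow> bool) \<Rightarrow> real set \<Rightarrow> (real \<Rightarrow> 'a) \<Rightarrow> bool" where
  "causal_curve_on leq I \<gamma> \<longleftrightarrow>
     is_interval I \<and> continuous_on I \<gamma> \<and> (\<forall>s\<in>I. \<forall>t\<in>I. s \<le> t \<longrightarrow> leq (\<gamma> s) (\<gamma> t))"

definition initial_points :: "('a \<Rightarrow> 'a \<Rightarrow> bool) \<Rightarrow> 'a set \<Rightarrow> 'a set" where
  "initial_points leq H = {m \<in> H. \<nexists>x. x \<in> H \<and> leq x m \<and> x \<noteq> m}"

definition final_points :: "('a \<Rightarrow> 'a \<Rightarrow> bool) \<Rightarrow> 'a set \<Rightarrow> 'a set" where
  "final_points leq H = {m \<in> H. \<nexists>x. x \<in> H \<and> leq m x \<and> x \<noteq> m}"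

definition static_points :: "('a \<Rightarrow> 'a \<Rightarrow> bool) \<Rightarrow> 'a set \<Rightarrow> 'a set" where
  "static_points leq H = initial_points leq H \<inter> final_points leq H"

definition inner_points :: "('a \<Rightarrow> 'a \<Rightarrow> bool) \<Rightarrow> 'a set \<Rightarrow> 'a set" where
  "inner_points leq H = H - (initial_points leq H \<union> final_points leq H)"

definition forward_null_nonbranching ::
  "('a::topological_space \<Rightarrow> 'a \<Rightarrow> bool) \<Rightarrow> 'a set \<Rightarrow> bool" where
  "forward_null_nonbranching leq H \<longleftrightarrow>
     (\<forall>\<gamma>1 \<gamma>2. causal_curve_on leq {0..1} \<gamma>1 \<and> inj_on \<gamma>1 {0..1} \<and> \<gamma>1 ` {0..1} \<subseteq> H \<and>
             causal_curve_on leq {0..1} \<gamma>2 \<and> inj_on \<gamma>2 {0..1} \<and> \<gamma>2 ` {0..1} \<subseteq> H \<and>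
             \<gamma>1 0 = \<gamma>2 0 \<and> \<gamma>1 (1/2) = \<gamma>2 (1/2) \<longrightarrow>
             \<gamma>1 ` {0..1} \<subseteq> \<gamma>2 ` {0..1} \<or> \<gamma>2 ` {0..1} \<subseteq> \<gamma>1 ` {0..1})"

definition backward_null_nonbranching ::
  "('a::topological_space \<Rightarrow> 'a \<Rightarrow> bool) \<Rightarrow> 'a set \<Rightarrow> bool" where
  "backward_null_nonbranching leq H \<longleftrightarrow> forward_null_nonbranching (\<lambda>x y. leq y x) H"

definition null_nonbranching ::
  "('a::topological_space \<Rightarrow> 'a \<Rightarrow> bool) \<Rightarrow> 'a set \<Rightarrow> bool" where
  "null_nonbranching leq H \<longleftrightarrow>
     forward_null_nonbranching leq H \<and> backward_null_nonbranching leq H"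

text \<open>Only the values of \<open>G\<close> on \<open>inner_points leq H\<close> matter.\<close>

definition null_gauge ::
  "('a::topological_space \<Rightarrow> 'a \<Rightarrow> bool) \<Rightarrow> 'a set \<Rightarrow> ('a \<Rightarrow> real) \<Rightarrow> bool" where
  "null_gauge leq H G \<longleftrightarrow>
     G \<in> borel_measurable (restrict_space borel (inner_points leq H)) \<and>
     (\<forall>I \<gamma>. causal_curve_on leq I \<gamma> \<and> inj_on \<gamma> I \<and> \<gamma> ` I \<subseteq> inner_points leq H \<longrightarrow>
        strict_mono_on I (G \<circ> \<gamma>) \<and> continuous_on I (G \<circ> \<gamma>)) \<and>
     (\<forall>\<gamma>. causal_curve_on leq {0..1} \<gamma> \<and> \<gamma> ` {0..1} \<subseteq> H \<and>
          \<gamma> ` {0<..<1} \<subseteq> inner_points leq H \<longrightarrow>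
        bdd_above ((G \<circ> \<gamma>) ` {0<..<1}) \<and> bdd_below ((G \<circ> \<gamma>) ` {0<..<1}))"

definition radon_measure_on :: "'a::topological_space set \<Rightarrow> 'a measure \<Rightarrow> bool" where
  "radon_measure_on H M \<longleftrightarrow>
     sets M = sets (restrict_space borel H) \<and>
     (\<forall>K. compact K \<and> K \<subseteq> H \<longrightarrow> emeasure M K < \<infinity>) \<and>
     (\<forall>A\<in>sets M. emeasure M A = (SUP K\<in>{K. compact K \<and> K \<subseteq> A}. emeasure M K))"

definition synthetic_null_hypersurface ::
  "('a::topological_space \<Rightarrow> 'a \<Rightarrow> bool) \<Rightarrow> ('a \<Rightarrow> 'a \<Rightarrow> bool) \<Rightarrow>
   'a set \<Rightarrow> ('a \<Rightarrow> real) \<Rightarrow> 'a measure \<Rightarrow> bool" where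
  "synthetic_null_hypersurface chron leq H G \<mm> \<longleftrightarrow>
     closed H \<and> achronal chron H \<and> null_gauge leq H G \<and>
     radon_measure_on H \<mm> \<and> static_points leq H \<in> null_sets \<mm>"

definition borel_prob_on :: "'a::topological_space set \<Rightarrow> 'a measure \<Rightarrow> bool" where
  "borel_prob_on H \<mu> \<longleftrightarrow> prob_space \<mu> \<and> sets \<mu> = sets (restrict_space borel H)"

definition causal_couplings ::
  "('a::topological_space \<Rightarrow> 'a \<Rightarrow> bool) \<Rightarrow> 'a set \<Rightarrow> 'a measure \<Rightarrow> 'a measure \<Rightarrow>
   ('a \<times> 'a) measure set" where
  "causal_couplings leq H \<mu>0 \<mu>1 =
     {\<pi>. borel_prob_on (H \<times> H) \<pi> \<and>
         distr \<pi> (restrict_space borel H) fst = \<mu>0 \<and>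
         distr \<pi> (restrict_space borel H) snd = \<mu>1 \<and>
         emeasure \<pi> {(x, y). x \<in> H \<and> y \<in> H \<and> leq x y} = 1}"

text \<open>Curves in \<open>C([0,1]; H)\<close> are extensional: they are \<open>undefined\<close> outside \<open>[0,1]\<close>.\<close>

definition curve_space :: "'a::metric_space set \<Rightarrow> (real \<Rightarrow> 'a) metric" where
  "curve_space H = cfunspace (top_of_set {0..1}) (submetric euclidean_metric H)"

definition borel_curves :: "'a::metric_space set \<Rightarrow> (real \<Rightarrow> 'a) measure" where
  "borel_curves H =
     sigma (mspace (curve_space H)) {U. openin (mtopology_of (curve_space H)) U}"

definition G_causal_curves ::
  "('a::metric_space \<Rightarrow> 'a \<Rightarrow> bool) \<Rightarrow> 'a set \<Rightarrow> ('a \<Rightarrow> real) \<Rightarrow> (real \<Rightarrow> 'a) set" where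
  "G_causal_curves leq H G =
     {\<gamma> \<in> mspace (curve_space H).
        (\<exists>x. \<forall>t\<in>{0..1}. \<gamma> t = x) \<or>
        (causal_curve_on leq {0..1} \<gamma> \<and> \<gamma> ` {0<..<1} \<subseteq> inner_points leq H \<and>
         (\<exists>a b. \<forall>t\<in>{0<..<1}. G (\<gamma> t) = a * t + b))}"

definition marginal :: "'a::metric_space set \<Rightarrow> (real \<Rightarrow> 'a) measure \<Rightarrow> real \<Rightarrow> 'a measure" where
  "marginal H \<nu> t = distr \<nu> (restrict_space borel H) (\<lambda>\<gamma>. \<gamma> t)"

text \<open>The condition that \<open>\<nu>\<close> gives mass 1 to the \<open>G\<close>-causal curves is written with \<open>AE\<close>, because
  \<open>emeasure\<close> is 0 on non-measurable sets: it holds iff these curves contain a Borel set of full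
  measure.\<close>

definition OptGeo ::
  "('a::metric_space \<Rightarrow> 'a \<Rightarrow> bool) \<Rightarrow> 'a set \<Rightarrow> ('a \<Rightarrow> real) \<Rightarrow> 'a measure \<Rightarrow> 'a measure \<Rightarrow>
   (real \<Rightarrow> 'a) measure set" where
  "OptGeo leq H G \<mu>0 \<mu>1 =
     {\<nu>. prob_space \<nu> \<and> sets \<nu> = sets (borel_curves H) \<and>
         marginal H \<nu> 0 = \<mu>0 \<and> marginal H \<nu> 1 = \<mu>1 \<and>
         (AE \<gamma> in \<nu>. \<gamma> \<in> G_causal_curves leq H G)}"

text \<open>As \<open>ennreal\<close> sends negative numbers to 0, the two integrals below are those of the positive
  and of the negative part of \<open>\<rho> log \<rho>\<close>; the second one may be infinite. Also \<open>0 * ln 0 = 0\<close>.\<close>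

definition Ent :: "'a measure \<Rightarrow> 'a measure \<Rightarrow> ereal" where
  "Ent \<mu> \<mm> =
     (let \<rho> = (\<lambda>x. enn2real (RN_deriv \<mm> \<mu> x));
          P = (\<integral>\<^sup>+ x. ennreal (\<rho> x * ln (\<rho> x)) \<partial>\<mm>);
          Q = (\<integral>\<^sup>+ x. ennreal (- (\<rho> x * ln (\<rho> x))) \<partial>\<mm>)
      in if (\<exists>f\<in>borel_measurable \<mm>. density \<mm> f = \<mu>) \<and> P < \<infinity>
         then enn2ereal P - enn2ereal Q else \<infinity>)"

definition U_ent :: "real \<Rightarrow> 'a measure \<Rightarrow> 'a measure \<Rightarrow> ennreal" where
  "U_ent k \<mu> \<mm> =
     (case Ent \<mu> \<mm> of ereal r \<Rightarrow> ennreal (exp (- r / k)) | PInfty \<Rightarrow> 0 | MInfty \<Rightarrow> \<infinity>)"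

definition NCe ::
  "('a::metric_space \<Rightarrow> 'a \<Rightarrow> bool) \<Rightarrow> 'a set \<Rightarrow> ('a \<Rightarrow> real) \<Rightarrow> 'a measure \<Rightarrow> real \<Rightarrow> bool" where
  "NCe leq H G \<mm> N \<longleftrightarrow>
     (\<forall>\<mu>0 \<mu>1. borel_prob_on H \<mu>0 \<and> borel_prob_on H \<mu>1 \<and> causal_couplings leq H \<mu>0 \<mu>1 \<noteq> {} \<longrightarrow>
        (\<exists>\<nu>\<in>OptGeo leq H G \<mu>0 \<mu>1. \<forall>t\<in>{0..1}.
           U_ent (N - 1) (marginal H \<nu> t) \<mm> \<ge>
             ennreal (1 - t) * U_ent (N - 1) \<mu>0 \<mm> + ennreal t * U_ent (N - 1) \<mu>1 \<mm>))"

end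

theory Submission
  imports Defs
begin

text \<open>Suppose the initial points have positive measure. As almost none of them is static, there are a
  compact set \<open>K\<close> of initial points with positive measure and, by measurable selection, a measurable
  \<open>T\<close> with \<open>x \<le> T x \<noteq> x\<close> on \<open>K\<close>. Interpolating between the uniform measure on \<open>K\<close> and its image under
  \<open>T\<close> produces curves whose midpoints are inner points lying above an initial point. By backward
  non-branching the past of such a midpoint inside \<open>H\<close> is a single arc, hence bounded. Conditioning on
  the event that the past of the midpoint lies in a fixed ball, one obtains a new pair of measures, the
  first still with bounded density; every interpolation between them stays in that ball and leaves \<open>K\<close>
  at once, since inner points are not initial. For small times the interpolating measures thus
  concentrate on punctured neighbourhoods of \<open>K\<close>, whose measure tends to 0, which forces their entropy
  to infinity. The energy condition bounds that entropy from above: a contradiction. The final points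
  are the initial points of the reversed order.

  Non-branching is applied to injective curves. These exist because the gauge makes the causal relation
  antisymmetric on \<open>H\<close>: two distinct equivalent points would be joined by an arc that is causal in both
  directions, along which the gauge would have to increase both ways.\<close>

section \<open>Arcs and measurable selection\<close>

text \<open>The Kuratowski embedding. Subtracting the distance to a base point makes the distance
  functions bounded, and the supremum distance between the images of \<open>x\<close> and
  \<open>y\<close> is attained at \<open>y\<close>. It places an arbitrary metric space inside a
  Banach space.\<close>

lemma isometric_embedding_bcontfun:
  obtains \<Phi> :: "'a::metric_space \<Rightarrow> 'a \<Rightarrow>\<^sub>C real" where "\<And>x y. dist (\<Phi> x) (\<Phi> y) = dist x y"
proof -
  fix x0 :: 'a
  define \<Phi> :: "'a \<Rightarrow> 'a \<Rightarrow>\<^sub>C real" where "\<Phi> x = Bcontfun (\<lambda>y. dist x y - dist x0 y)" for x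
  have *: "apply_bcontfun (\<Phi> x) y = dist x y - dist x0 y" for x y
  proof -
    have "(\<lambda>y. dist x y - dist x0 y) \<in> bcontfun"
    proof (rule bcontfun_normI)
      show "norm (dist x y - dist x0 y) \<le> dist x x0" for y
        using dist_triangle[of x y x0] dist_triangle[of x0 y x] by (auto simp: dist_commute abs_le_iff)
    qed (intro continuous_intros)
    then show ?thesis by (simp add: \<Phi>_def Bcontfun_inverse)
  qed
  have "dist (\<Phi> x) (\<Phi> y) = dist x y" for x y
  proof (rule antisym)
    show "dist (\<Phi> x) (\<Phi> y) \<le> dist x y"
    proof (rule dist_bound)
      show "dist (apply_bcontfun (\<Phi> x) z) (apply_bcontfun (\<Phi> y) z) \<le> dist x y" for z
        using dist_triangle[of x z y] dist_triangle[of y z x]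
        by (auto simp: * dist_real_def dist_commute abs_le_iff)
    qed
    show "dist x y \<le> dist (\<Phi> x) (\<Phi> y)"
      using dist_bounded[of "\<Phi> x" y "\<Phi> y"] by (simp add: * dist_real_def)
  qed
  then show thesis by (rule that)
qed

text \<open>The path is pushed into the Banach space, an arc is extracted there and pulled back. The
  arc stays in the image of the path, hence in the range of the embedding, on which the inverse is
  again an isometry.\<close>

lemma path_contains_arc_metric:
  fixes p :: "real \<Rightarrow> 'a::metric_space"
  assumes p: "path p" and ne: "pathstart p \<noteq> pathfinish p"
  obtains q where "arc q" "path_image q \<subseteq> path_image p"
    "pathstart q = pathstart p" "pathfinish q = pathfinish p"
proof -
  obtain \<Phi> :: "'a \<Rightarrow> 'a \<Rightarrow>\<^sub>C real" where \<Phi>: "\<And>x y. dist (\<Phi> x) (\<Phi> y) = dist x y"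
    using isometric_embedding_bcontfun by blast
  have inj: "\<Phi> x = \<Phi> y \<longleftrightarrow> x = y" for x y
    using \<Phi>[of x y] by (metis dist_eq_0_iff)
  then have inv: "inv \<Phi> (\<Phi> x) = x" for x
    by (simp add: inj_def inv_f_f)
  have "continuous_on UNIV \<Phi>"
    by (auto simp: continuous_on_iff \<Phi>)
  then have "path (\<Phi> \<circ> p)"
    using p by (intro path_continuous_image) (auto intro: continuous_on_subset)
  moreover have "pathstart (\<Phi> \<circ> p) = \<Phi> (pathstart p)" "pathfinish (\<Phi> \<circ> p) = \<Phi> (pathfinish p)"
    by (auto simp: pathstart_def pathfinish_def)
  ultimately obtain q where q: "arc q" "path_image q \<subseteq> path_image (\<Phi> \<circ> p)"
    "pathstart q = \<Phi> (pathstart p)" "pathfinish q = \<Phi> (pathfinish p)"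
    using ne inj path_contains_arc by metis
  have sub: "path_image q \<subseteq> \<Phi> ` path_image p"
    using q(2) by (simp add: path_image_def image_comp)
  then have rng: "path_image q \<subseteq> range \<Phi>" using image_mono[OF subset_UNIV] by (rule order_trans)
  have "continuous_on (range \<Phi>) (inv \<Phi>)" by (auto simp: continuous_on_iff inv \<Phi>)
  then have "continuous_on (path_image q) (inv \<Phi>)" using rng by (rule continuous_on_subset)
  moreover have "inj_on (inv \<Phi>) (range \<Phi>)" by (auto simp: inj_on_def inv)
  then have "inj_on (inv \<Phi>) (path_image q)" using rng by (rule inj_on_subset)
  ultimately have "arc (inv \<Phi> \<circ> q)"
    using q(1) unfolding arc_def
    by (auto intro!: path_continuous_image comp_inj_on simp flip: path_image_def)
  moreover have "path_image (inv \<Phi> \<circ> q) \<subseteq> path_image p"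
  proof -
    have "inv \<Phi> ` path_image q \<subseteq> inv \<Phi> ` \<Phi> ` path_image p" using sub by (rule image_mono)
    also have "\<dots> = path_image p" by (simp add: image_image inv)
    finally show ?thesis by (simp add: path_image_def image_comp)
  qed
  ultimately show thesis
    using that[of "inv \<Phi> \<circ> q"] q(3,4) by (simp add: pathstart_def pathfinish_def inv)
qed

text \<open>An arc inside a chain cannot turn back: by connectedness it would have to pass a second time
  through the point to which it returns.\<close>

lemma arc_in_chain_mono:
  fixes q :: "real \<Rightarrow> 'a::metric_space"
  assumes q: "arc q"
    and closed: "closed {(x, y). leq x y}"
    and total: "\<And>x y. x \<in> path_image q \<Longrightarrow> y \<in> path_image q \<Longrightarrow> leq x y \<or> leq y x"
    and antisym: "\<And>x y. x \<in> path_image q \<Longrightarrow> y \<in> path_image q \<Longrightarrow> leq x y \<Longrightarrow> leq y x \<Longrightarrow> x = y"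
    and start: "\<And>x. x \<in> path_image q \<Longrightarrow> leq (pathstart q) x"
    and st: "s \<in> {0..1}" "t \<in> {0..1}" "s \<le> t"
  shows "leq (q s) (q t)"
proof (rule ccontr)
  assume neg: "\<not> leq (q s) (q t)"
  have img: "q w \<in> path_image q" if "w \<in> {0..1}" for w
    using that by (auto simp: path_image_def)
  have ts: "leq (q t) (q s)"
    using neg total img st by blast
  have cont: "continuous_on {0..s} q"
    using q st by (auto simp: arc_def path_def intro: continuous_on_subset)
  let ?A = "{w \<in> {0..s}. leq (q w) (q t)}" and ?B = "{w \<in> {0..s}. leq (q t) (q w)}"
  have "closed ({0..s} \<inter> (\<lambda>w. (q w, q t)) -` {(x, y). leq x y})"
    by (intro continuous_closed_preimage continuous_intros cont closed)
  moreover have "closed ({0..s} \<inter> (\<lambda>w. (q t, q w)) -` {(x, y). leq x y})"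
    by (intro continuous_closed_preimage continuous_intros cont closed)
  ultimately have "closed ?A" "closed ?B"
    by (simp_all add: Int_def vimage_def)
  moreover have "{0..s} \<subseteq> ?A \<union> ?B"
  proof
    fix w assume "w \<in> {0..s}"
    then show "w \<in> ?A \<union> ?B"
      using total[OF img[of w] img[of t]] st by auto
  qed
  moreover have "0 \<in> ?A" "s \<in> ?B"
    using st ts start[of "q t"] img by (auto simp: pathstart_def)
  ultimately have "?A \<inter> ?B \<noteq> {}"
    using connected_closedD[of "{0..s}" ?A ?B] connected_Icc[of 0 s] by blast
  then obtain w where w: "w \<in> {0..s}" "leq (q w) (q t)" "leq (q t) (q w)" by blast
  then have "q w = q t"
    using st by (intro antisym img) auto
  then have "w = t"
    using q st w by (auto simp: arc_def inj_on_def)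
  then have "s = t" using w st by auto
  then show False using neg ts by simp
qed

text \<open>A selection of Kuratowski and Ryll-Nardzewski type. Over a point of the domain, the
  sections \<open>D n x\<close> are nonempty, compact and decreasing, and their diameters tend to 0,
  so they shrink to the single point \<open>T x\<close>. Measurability comes from the sets of all
  \<open>x\<close> whose section meets a given closed set.\<close>

lemma compact_relation_selection:
  fixes C :: "('a::metric_space \<times> 'b::{metric_space, second_countable_topology}) set"
  assumes C: "compact C"
  obtains T where "T \<in> borel \<rightarrow>\<^sub>M borel" "\<And>x. x \<in> fst ` C \<Longrightarrow> (x, T x) \<in> C"
proof -
  obtain E :: "'b set" where E: "countable E" "\<And>X. open X \<Longrightarrow> X \<noteq> {} \<Longrightarrow> \<exists>d \<in> E. d \<in> X"
    using countable_dense_setE by blast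
  have "E \<noteq> {}" using E(2)[of UNIV] by auto
  define d where "d = from_nat_into E"
  have d: "\<exists>i. y \<in> cball (d i) r" if r: "r > 0" for y r
  proof -
    obtain e where "e \<in> E" "e \<in> ball y r"
      using E(2)[of "ball y r"] r by (metis centre_in_ball empty_iff open_ball)
    moreover have "d (to_nat_on E e) = e"
      using \<open>e \<in> E\<close> E(1) by (simp add: d_def)
    ultimately show ?thesis
      by (intro exI[of _ "to_nat_on E e"]) (simp add: dist_commute less_imp_le)
  qed
  define r :: "nat \<Rightarrow> real" where "r n = (1/2) ^ n" for n
  \<comment> \<open>Shrink the section over \<open>x\<close> by successively intersecting it with the first ball of radius
    \<open>r n\<close> that it meets.\<close>
  define D where "D = rec_nat (\<lambda>x. {y. (x, y) \<in> C})
     (\<lambda>n D x. D x \<inter> cball (d (LEAST i. D x \<inter> cball (d i) (r n) \<noteq> {})) (r n))"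
  define I where "I n x = (LEAST i. D n x \<inter> cball (d i) (r n) \<noteq> {})" for n x
  have D0: "D 0 x = {y. (x, y) \<in> C}" for x by (simp add: D_def)
  have DS: "D (Suc n) x = D n x \<inter> cball (d (I n x)) (r n)" for n x by (simp add: D_def I_def)
  have comp: "compact (D n x)" for n x
  proof (induction n)
    case 0
    have "D 0 x = snd ` (C \<inter> {x} \<times> UNIV)" by (force simp: D0)
    moreover have "compact (snd ` (C \<inter> {x} \<times> UNIV))"
      by (intro compact_continuous_image compact_Int_closed C closed_Times continuous_intros) 
    ultimately show ?case by simp
  qed (auto simp: DS intro: compact_Int_closed)
  have least: "D n x \<inter> cball (d (I n x)) (r n) \<noteq> {}" if "D n x \<noteq> {}" for n x
  proof -
    from that obtain y where "y \<in> D n x" by blast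
    moreover obtain i where "y \<in> cball (d i) (r n)"
      using d[of "r n" y] by (auto simp: r_def)
    ultimately have "D n x \<inter> cball (d i) (r n) \<noteq> {}" by blast
    then show ?thesis unfolding I_def by (rule LeastI)
  qed
  have ne: "D n x \<noteq> {}" if "x \<in> fst ` C" for n x
    using that by (induction n) (auto simp: D0 DS least)
  have meas: "{x. D n x \<inter> F \<noteq> {}} \<in> sets borel" if "closed F" for n F
    using that
  proof (induction n arbitrary: F)
    case 0
    have "{x. D 0 x \<inter> F \<noteq> {}} = fst ` (C \<inter> UNIV \<times> F)" by (force simp: D0)
    moreover have "compact (fst ` (C \<inter> UNIV \<times> F))"
      by (intro compact_continuous_image compact_Int_closed C closed_Times continuous_intros 0)
    ultimately show ?case by (simp add: borel_compact)
  next
    case (Suc n)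
    \<comment> \<open>Split according to the index \<open>i\<close> of the first ball that the
      section meets: this ball is met and no earlier one is. The induction hypothesis covers both
      kinds of condition because balls here are closed.\<close>
    have "{x. D (Suc n) x \<inter> F \<noteq> {}} =
       (\<Union>i. {x. D n x \<inter> (cball (d i) (r n) \<inter> F) \<noteq> {}} -
          (\<Union>j<i. {x. D n x \<inter> cball (d j) (r n) \<noteq> {}}))" (is "?L = ?R")
    proof (rule set_eqI, rule iffI)
      fix x assume "x \<in> ?L"
      then have "D n x \<inter> (cball (d (I n x)) (r n) \<inter> F) \<noteq> {}" by (simp add: DS Int_assoc)
      moreover have "D n x \<inter> cball (d j) (r n) = {}" if "j < I n x" for j
        using not_less_Least[OF that[unfolded I_def]] by simp
      ultimately show "x \<in> ?R" by (intro UN_I[of "I n x"]) simp_all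
    next
      fix x assume "x \<in> ?R"
      then obtain i where i: "D n x \<inter> (cball (d i) (r n) \<inter> F) \<noteq> {}"
        "\<And>j. j < i \<Longrightarrow> D n x \<inter> cball (d j) (r n) = {}" by blast
      have "I n x = i"
        unfolding I_def
      proof (rule Least_equality)
        show "D n x \<inter> cball (d i) (r n) \<noteq> {}" using i(1) by blast
        show "i \<le> j" if "D n x \<inter> cball (d j) (r n) \<noteq> {}" for j
          using i(2)[of j] that by (meson not_le)
      qed
      then show "x \<in> ?L" using i(1) by (simp add: DS Int_assoc)
    qed
    moreover have "?R \<in> sets borel"
    proof -
      have "{x. D n x \<inter> (cball (d i) (r n) \<inter> F) \<noteq> {}} \<in> sets borel" for i
        by (intro Suc.IH closed_Int closed_cball Suc.prems)
      moreover have "{x. D n x \<inter> cball (d j) (r n) \<noteq> {}} \<in> sets borel" for j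
        by (intro Suc.IH closed_cball)
      ultimately show ?thesis by (intro sets.countable_UN'[OF countableI_type] sets.Diff sets.finite_UN) blast+
    qed
    ultimately show ?case by simp
  qed
  have dec: "D n x \<subseteq> D m x" if "m \<le> n" for m n x
    using that by (induction n) (auto simp: DS le_Suc_eq)
  have nested: "(\<Inter>n. D n x \<inter> F) \<noteq> {}" if "closed F" "\<And>n. D n x \<inter> F \<noteq> {}" for x F
  proof -
    have cpt: "compact (D n x \<inter> F)" for n using comp that(1) by (rule compact_Int_closed)
    have "(D 0 x \<inter> F) \<inter> (\<Inter>n\<in>UNIV. D n x \<inter> F) \<noteq> {}"
    proof (rule compact_imp_fip_image)
      fix J :: "nat set" assume "finite J"
      then have "D (Max (insert 0 J)) x \<subseteq> D j x" if "j \<in> insert 0 J" for j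
        using that by (intro dec Max_ge) auto
      then have "D (Max (insert 0 J)) x \<inter> F \<subseteq> (D 0 x \<inter> F) \<inter> (\<Inter>n\<in>J. D n x \<inter> F)"
        by blast
      then show "(D 0 x \<inter> F) \<inter> (\<Inter>n\<in>J. D n x \<inter> F) \<noteq> {}" using that(2) by blast
    qed (use cpt in \<open>auto intro: compact_imp_closed\<close>)
    then show ?thesis by blast
  qed
  have uniq: "y = z" if "\<And>n. y \<in> D n x" "\<And>n. z \<in> D n x" for x y z
  proof -
    have "dist y z \<le> 2 * r n" for n
      using that[of "Suc n"] dist_triangle2[of y z "d (I n x)"] by (auto simp: DS dist_commute)
    moreover have "(\<lambda>n. 2 * r n) \<longlonglongrightarrow> 2 * 0"
      unfolding r_def by (intro tendsto_intros LIMSEQ_power_zero) auto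
    ultimately have "dist y z \<le> 0"
      by (intro LIMSEQ_le_const[of "\<lambda>n. 2 * r n"]) auto
    then show ?thesis by simp
  qed
  \<comment> \<open>Off the domain of \<open>C\<close> the map is constant, which keeps it Borel on
    the whole space; hence the case distinction on \<open>undefined \<in> S\<close> below.\<close>
  define T where "T x = (if x \<in> fst ` C then SOME y. \<forall>n. y \<in> D n x else undefined)" for x
  have T: "T x \<in> D n x" if "x \<in> fst ` C" for n x
  proof -
    have "\<exists>y. \<forall>n. y \<in> D n x" using nested[of UNIV x] ne[OF that] by auto
    then have "\<forall>n. (SOME y. \<forall>n. y \<in> D n x) \<in> D n x" by (rule someI_ex)
    then show ?thesis using that by (simp add: T_def)
  qed
  have dom: "fst ` C \<in> sets borel"
    by (intro borel_compact compact_continuous_image C continuous_intros)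
  have "T \<in> borel_measurable borel"
  proof (rule borel_measurableI)
    fix S :: "'b set" assume "open S"
    \<comment> \<open>If all sections over \<open>x\<close> meet the closed set \<open>- S\<close>,
      compactness gives a common point of them in \<open>- S\<close>, and by \<open>uniq\<close>
      this point is \<open>T x\<close>.\<close>
    have eq: "T -` (- S) \<inter> fst ` C = (\<Inter>n. {x. D n x \<inter> - S \<noteq> {}})"
    proof (rule set_eqI, rule iffI)
      fix x assume "x \<in> T -` (- S) \<inter> fst ` C"
      then show "x \<in> (\<Inter>n. {x. D n x \<inter> - S \<noteq> {}})" using T by blast
    next
      fix x assume x: "x \<in> (\<Inter>n. {x. D n x \<inter> - S \<noteq> {}})"
      then obtain y where y: "\<And>n. y \<in> D n x" "y \<notin> S"
        using nested[of "- S" x] \<open>open S\<close> by (auto simp: closed_def)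
      have "x \<in> fst ` C" using y(1)[of 0] by (force simp: D0)
      moreover have "T x = y" by (rule uniq[OF T y(1)]) fact
      ultimately show "x \<in> T -` (- S) \<inter> fst ` C" using y by auto
    qed
    have "T -` (- S) \<inter> fst ` C \<in> sets borel"
      unfolding eq using \<open>open S\<close> by (intro sets.countable_INT') (auto intro!: meas simp: closed_def)
    then have *: "fst ` C - (T -` (- S) \<inter> fst ` C) \<in> sets borel"
      using dom by auto
    have "T -` S \<inter> space borel = (fst ` C - (T -` (- S) \<inter> fst ` C)) \<union>
       (if undefined \<in> S then - fst ` C else {})"
      by (auto simp: T_def split: if_splits)
    then show "T -` S \<inter> space borel \<in> sets borel"
      using * dom by (auto split: if_splits)
  qed
  moreover have "(x, T x) \<in> C" if "x \<in> fst ` C" for x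
    using T[OF that, of 0] by (simp add: D0)
  ultimately show thesis by (rule that)
qed

section \<open>Entropy bounds\<close>

lemma radon_measure_on_sigma_finite:
  fixes H :: "'a::polish_space set"
  assumes R: "radon_measure_on H M" and proper: "\<And>(x::'a) r. compact (cball x r)" and H: "closed H"
  shows "sigma_finite_measure M"
proof
  fix x0 :: 'a
  have sets: "sets M = sets (restrict_space borel H)" using R by (simp add: radon_measure_on_def)
  have "emeasure M (H \<inter> cball x0 (real n)) \<noteq> \<infinity>" for n
    using R proper[of x0 n] H by (auto simp: radon_measure_on_def less_top[symmetric] compact_Int_closed Int_commute)
  moreover have "H \<inter> cball x0 (real n) \<in> sets M" for n
    using H by (auto simp: sets sets_restrict_space)
  moreover have "(\<Union>n. H \<inter> cball x0 (real n)) = space M"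
    using sets_eq_imp_space_eq[OF sets] by (auto simp: space_restrict_space real_arch_simple)
  ultimately show "\<exists>A. countable A \<and> A \<subseteq> sets M \<and> \<Union> A = space M \<and> (\<forall>a\<in>A. emeasure M a \<noteq> \<infinity>)"
    by (intro exI[of _ "range (\<lambda>n. H \<inter> cball x0 (real n))"]) auto
qed

text \<open>Domination by a multiple of \<open>M\<close> bounds the density almost everywhere, hence
  bounds its logarithm from above, and the density itself has integral 1.\<close>

lemma (in sigma_finite_measure) Ent_less_PInfty_if_le:
  assumes \<mu>: "prob_space \<mu>" and sets: "sets \<mu> = sets M"
    and c: "c \<ge> 0" and le: "\<And>A. A \<in> sets M \<Longrightarrow> emeasure \<mu> A \<le> ennreal c * emeasure M A"
  shows "Ent \<mu> M < \<infinity>"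
proof -
  interpret \<mu>: prob_space \<mu> by fact
  have ac: "absolutely_continuous M \<mu>"
    using le by (force simp: absolutely_continuous_def null_sets_def sets)
  define R where "R = RN_deriv M \<mu>"
  have [measurable]: "R \<in> borel_measurable M" by (simp add: R_def)
  have dens: "density M R = \<mu>" unfolding R_def by (rule density_RN_deriv[OF ac sets])
  \<comment> \<open>The slack 1 forces \<open>A\<close> to be null: its measure is finite, and
    \<open>c + 1\<close> times it is at most \<open>c\<close> times it. It also makes
    \<open>ln (c + 1)\<close> nonnegative.\<close>
  define A where "A = {x \<in> space M. R x > ennreal (c + 1)}"
  have [measurable]: "A \<in> sets M" by (simp add: A_def)
  have "ennreal (c + 1) * emeasure M A = (\<integral>\<^sup>+x. ennreal (c + 1) * indicator A x \<partial>M)"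
    by (simp add: nn_integral_cmult_indicator)
  also have "\<dots> \<le> (\<integral>\<^sup>+x. R x * indicator A x \<partial>M)"
    by (intro nn_integral_mono) (auto simp: A_def indicator_def)
  also have "\<dots> = emeasure \<mu> A"
    by (subst dens[symmetric]) (simp add: emeasure_density)
  finally have ge: "ennreal (c + 1) * emeasure M A \<le> emeasure \<mu> A" .
  have "emeasure M A \<le> ennreal (c + 1) * emeasure M A"
    using mult_right_mono[of "ennreal 1" "ennreal (c + 1)" "emeasure M A"] c by simp
  also have "\<dots> \<le> 1" using ge \<mu>.emeasure_le_1[of A] by (rule order_trans)
  finally obtain m where m: "emeasure M A = ennreal m" "m \<ge> 0"
    by (metis ennreal_cases ennreal_one_neq_top neq_top_trans)
  have "ennreal (c + 1) * ennreal m \<le> ennreal c * ennreal m"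
    using ge le[of A] m by simp
  then have "(c + 1) * m \<le> c * m"
    using c m by (simp flip: ennreal_mult ennreal_plus add: ennreal_le_iff del: ennreal_plus)
  then have "emeasure M A = 0" using m by (simp add: algebra_simps)
  then have bd: "AE x in M. R x \<le> ennreal (c + 1)"
    by (intro AE_I[of _ _ A]) (auto simp: A_def)
  have "(\<integral>\<^sup>+ x. ennreal (enn2real (R x) * ln (enn2real (R x))) \<partial>M) \<le>
      (\<integral>\<^sup>+ x. R x * ennreal (ln (c + 1)) \<partial>M)"
  proof (rule nn_integral_mono_AE)
    show "AE x in M. ennreal (enn2real (R x) * ln (enn2real (R x))) \<le> R x * ennreal (ln (c + 1))"
      using bd
    proof eventually_elim
      fix x assume "R x \<le> ennreal (c + 1)"
      then obtain r where r: "R x = ennreal r" "0 \<le> r" "r \<le> c + 1"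
        using c by (cases "R x") (auto simp: top_unique ennreal_le_iff simp del: ennreal_plus)
      have "r * ln r \<le> r * ln (c + 1)"
        using r c by (cases "r = 0") (auto intro!: mult_left_mono)
      then show "ennreal (enn2real (R x) * ln (enn2real (R x))) \<le> R x * ennreal (ln (c + 1))"
        using r c by (simp add: ennreal_leI flip: ennreal_mult)
    qed
  qed
  also have "\<dots> = (\<integral>\<^sup>+ x. R x \<partial>M) * ennreal (ln (c + 1))"
    by (rule nn_integral_multc) simp
  also have "(\<integral>\<^sup>+ x. R x \<partial>M) = emeasure \<mu> (space M)"
    by (subst dens[symmetric]) (simp add: emeasure_density cong: nn_integral_cong)
  also have "\<dots> = 1"
    using \<mu>.emeasure_space_1 sets_eq_imp_space_eq[OF sets] by simp
  finally have P: "(\<integral>\<^sup>+ x. ennreal (enn2real (R x) * ln (enn2real (R x))) \<partial>M) < \<infinity>"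
    using ennreal_less_top[of "ln (c + 1)"] by (simp add: le_less_trans)
  then have "enn2ereal (\<integral>\<^sup>+ x. ennreal (enn2real (R x) * ln (enn2real (R x))) \<partial>M) < \<infinity>"
    by (simp add: less_top[symmetric] flip: ereal_infty_less(1))
  then show ?thesis
    using P dens unfolding Ent_def Let_def R_def[symmetric]
    by (auto intro!: bexI[of _ R] simp: ereal_minus_less_iff ereal_minus_eq_PInfty_iff less_top[symmetric] 
       split: if_splits)
qed

text \<open>The Fenchel-Young inequality for \<open>x * ln x\<close>, whose convex conjugate at
  \<open>c\<close> is \<open>exp (c - 1)\<close>. For positive \<open>x\<close> it is
  \<open>exp u \<ge> 1 + u\<close> at \<open>u = c - 1 - ln x\<close>, multiplied by
  \<open>x\<close>.\<close>

lemma mult_ln_ge: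
  fixes x c :: real
  assumes "x \<ge> 0"
  shows "x * ln x \<ge> c * x - exp (c - 1)"
proof (cases "x = 0")
  case False
  then have x: "x > 0" using assms by simp
  have "exp (c - 1 - ln x) \<ge> 1 + (c - 1 - ln x)" by (rule exp_ge_add_one_self)
  then have "x * exp (c - 1 - ln x) \<ge> x * (c - ln x)" using x by simp
  moreover have "x * exp (c - 1 - ln x) = exp (c - 1)"
    using x by (simp add: exp_diff)
  ultimately show ?thesis by (simp add: algebra_simps)
qed simp

text \<open>Integrates \<open>mult_ln_ge\<close> with \<open>c = a\<close> on \<open>A\<close> and \<open>c = - b\<close> on \<open>B\<close>.\<close>

lemma Ent_lower_bound:
  assumes \<mu>: "prob_space \<mu>" and sets: "sets \<mu> = sets M"
    and A: "A \<in> sets M" and B: "B \<in> sets M" and disj: "A \<inter> B = {}"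
    and fin: "emeasure M A < \<infinity>" "emeasure M B < \<infinity>"
    and conc: "AE x in \<mu>. x \<in> A \<union> B" and ab: "a \<ge> 0" "b \<ge> 0"
  shows "Ent \<mu> M \<ge> ereal (a * measure \<mu> A - b * measure \<mu> B
           - exp (a - 1) * measure M A - exp (- b - 1) * measure M B)"
proof (cases "Ent \<mu> M = \<infinity>")
  case False
  interpret \<mu>: prob_space \<mu> by fact
  note [measurable] = A B
  define R where "R = RN_deriv M \<mu>"
  define r where "r x = enn2real (R x)" for x
  have [measurable]: "R \<in> borel_measurable M" "r \<in> borel_measurable M"
    unfolding R_def r_def by measurable
  define P where "P = (\<integral>\<^sup>+ x. ennreal (r x * ln (r x)) \<partial>M)"
  define Q where "Q = (\<integral>\<^sup>+ x. ennreal (- (r x * ln (r x))) \<partial>M)"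
  have E: "(\<exists>f\<in>borel_measurable M. density M f = \<mu>)" "P < \<infinity>" "Ent \<mu> M = enn2ereal P - enn2ereal Q"
    using False unfolding Ent_def Let_def r_def R_def P_def Q_def by (auto split: if_splits)
  have dens: "density M R = \<mu>" unfolding R_def using E(1) RN_derivI by blast
  have "(\<integral>\<^sup>+ x. R x \<partial>M) = emeasure \<mu> (space M)"
    by (subst dens[symmetric]) (simp add: emeasure_density cong: nn_integral_cong)
  also have "\<dots> \<noteq> \<infinity>" by simp
  finally have Rfin: "AE x in M. R x \<noteq> \<infinity>" by (intro nn_integral_PInf_AE) auto
  have Rr: "AE x in M. R x = ennreal (r x)"
    using Rfin by eventually_elim (simp add: r_def less_top)
  have conc': "AE x in M. R x > 0 \<longrightarrow> x \<in> A \<union> B"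
    using conc unfolding dens[symmetric] by (simp add: AE_density)
  have int: "(\<integral>\<^sup>+ x. ennreal (r x) * indicator S x \<partial>M) = ennreal (measure \<mu> S)" if "S \<in> sets M" for S
  proof -
    have "(\<integral>\<^sup>+ x. ennreal (r x) * indicator S x \<partial>M) = (\<integral>\<^sup>+ x. R x * indicator S x \<partial>M)"
      using Rr by (intro nn_integral_cong_AE) auto
    also have "\<dots> = emeasure \<mu> S" using that by (subst dens[symmetric]) (simp add: emeasure_density)
    finally show ?thesis by (simp add: \<mu>.emeasure_eq_measure)
  qed
  have mA: "emeasure M A = ennreal (measure M A)" and mB: "emeasure M B = ennreal (measure M B)"
    using fin by (auto simp: emeasure_eq_ennreal_measure)
  \<comment> \<open>All negative terms are moved across, so that both sides are sums of nonnegative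
    integrals. At this point \<open>Q\<close> might still be infinite; the resulting inequality
    shows that it is not.\<close>
  have "Q + ennreal a * ennreal (measure \<mu> A) =
      (\<integral>\<^sup>+ x. ennreal (- (r x * ln (r x))) + ennreal a * (ennreal (r x) * indicator A x) \<partial>M)"
    unfolding Q_def int[OF A, symmetric] by (simp add: nn_integral_add nn_integral_cmult)
  also have "\<dots> \<le> (\<integral>\<^sup>+ x. ennreal (r x * ln (r x)) + (ennreal (exp (a - 1)) * indicator A x +
       (ennreal (exp (- b - 1)) * indicator B x + ennreal b * (ennreal (r x) * indicator B x))) \<partial>M)"
  proof (rule nn_integral_mono_AE)
    show "AE x in M. ennreal (- (r x * ln (r x))) + ennreal a * (ennreal (r x) * indicator A x)
       \<le> ennreal (r x * ln (r x)) + (ennreal (exp (a - 1)) * indicator A x +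
       (ennreal (exp (- b - 1)) * indicator B x + ennreal b * (ennreal (r x) * indicator B x)))"
      using conc' Rr
    proof eventually_elim
      fix x assume x: "R x > 0 \<longrightarrow> x \<in> A \<union> B" "R x = ennreal (r x)"
      have r0: "r x \<ge> 0" by (simp add: r_def)
      have split: "ennreal (- y) + ennreal u \<le> ennreal y + ennreal v"
        if "u \<le> y + v" "u \<ge> 0" "v \<ge> 0" for y u v :: real
        using that by (cases "y \<ge> 0") (auto simp: ennreal_neg simp flip: ennreal_plus intro!: ennreal_leI)
      consider "x \<in> A" "x \<notin> B" | "x \<in> B" "x \<notin> A" | "r x = 0" "x \<notin> A" "x \<notin> B"
        using x r0 disj by fastforce
      then show "ennreal (- (r x * ln (r x))) + ennreal a * (ennreal (r x) * indicator A x)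
       \<le> ennreal (r x * ln (r x)) + (ennreal (exp (a - 1)) * indicator A x +
       (ennreal (exp (- b - 1)) * indicator B x + ennreal b * (ennreal (r x) * indicator B x)))"
      proof cases
        case 1
        then show ?thesis
          using split[of "a * r x" "r x * ln (r x)" "exp (a - 1)"] mult_ln_ge[OF r0, of a] ab r0
          by (simp add: ennreal_mult)
      next
        case 2
        then show ?thesis
          using split[of 0 "r x * ln (r x)" "exp (- b - 1) + b * r x"] mult_ln_ge[OF r0, of "- b"] ab r0
          by (simp add: ennreal_mult ennreal_plus)
      qed simp
    qed
  qed
  also have "\<dots> = P + (ennreal (exp (a - 1)) * emeasure M A +
      (ennreal (exp (- b - 1)) * emeasure M B + ennreal b * ennreal (measure \<mu> B)))"
    unfolding P_def int[OF B, symmetric]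
    by (simp add: nn_integral_add nn_integral_cmult nn_integral_cmult_indicator)
  finally have ineq: "Q + ennreal (a * measure \<mu> A) \<le> P + ennreal (exp (a - 1) * measure M A +
      (exp (- b - 1) * measure M B + b * measure \<mu> B))"
    using ab by (simp add: mA mB ennreal_mult ennreal_plus)
  obtain p where p: "P = ennreal p" "p \<ge> 0" using E(2) by (cases P) auto
  have "Q < \<infinity>"
  proof -
    have "Q \<le> Q + ennreal (a * measure \<mu> A)" by simp
    also note ineq
    also have "P + ennreal (exp (a - 1) * measure M A +
      (exp (- b - 1) * measure M B + b * measure \<mu> B)) < \<infinity>" using p by simp
    finally show ?thesis .
  qed
  then obtain q where q: "Q = ennreal q" "q \<ge> 0" by (cases Q) auto
  have "q + a * measure \<mu> A \<le> p + (exp (a - 1) * measure M A +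
      (exp (- b - 1) * measure M B + b * measure \<mu> B))"
    using ineq ab p q by (simp flip: ennreal_plus)
  then show ?thesis using E(3) p q by (simp add: enn2ereal_ennreal)
qed simp

lemma U_ent_pos_iff: "U_ent k \<mu> M > 0 \<longleftrightarrow> Ent \<mu> M < \<infinity>"
  by (cases "Ent \<mu> M") (auto simp: U_ent_def)

lemma Ent_le_if_U_ent_ge:
  assumes "U_ent k \<mu> M \<ge> ennreal r" "r > 0" "k > 0"
  shows "Ent \<mu> M \<le> ereal (- k * ln r)"
proof (cases "Ent \<mu> M")
  case (real e)
  then have "r \<le> exp (- e / k)" using assms by (simp add: U_ent_def)
  then have "ln r \<le> - e / k" using assms by (metis exp_gt_zero ln_exp ln_le_cancel_iff)
  then show ?thesis using assms real by (simp add: field_simps)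
qed (use assms in \<open>auto simp: U_ent_def\<close>)

section \<open>Interpolation along null curves\<close>

text \<open>What is left of \<open>G_causal_curves\<close> when the affine parametrization is
  forgotten. The condition on the endpoints takes the place of the case of constant curves.\<close>

definition null_curve ::
  "('a::topological_space \<Rightarrow> 'a \<Rightarrow> bool) \<Rightarrow> 'a set \<Rightarrow> (real \<Rightarrow> 'a) \<Rightarrow> bool" where
  "null_curve leq H \<gamma> \<longleftrightarrow> causal_curve_on leq {0..1} \<gamma> \<and> \<gamma> ` {0..1} \<subseteq> H \<and>
     (\<gamma> 0 \<noteq> \<gamma> 1 \<longrightarrow> \<gamma> ` {0<..<1} \<subseteq> inner_points leq H)"

text \<open>The part of the null energy condition that the argument needs, for couplings \<open>(f, g)\<close> and
  interpolations \<open>X\<close> given as random variables: in this form, time reversal amounts to replacing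
  \<open>X t\<close> by \<open>X (1 - t)\<close> and swapping \<open>f\<close> with \<open>g\<close>.\<close>

definition null_interpolation ::
  "('a::topological_space \<Rightarrow> 'a \<Rightarrow> bool) \<Rightarrow> 'a set \<Rightarrow> 'a measure \<Rightarrow> real \<Rightarrow> bool" where
  "null_interpolation leq H M k \<longleftrightarrow>
     (\<forall>(P :: ('a \<times> 'a) measure) f g.
        prob_space P \<and> f \<in> P \<rightarrow>\<^sub>M restrict_space borel H \<and> g \<in> P \<rightarrow>\<^sub>M restrict_space borel H \<and>
        (AE z in P. leq (f z) (g z)) \<longrightarrow>
        (\<exists>(\<nu> :: (real \<Rightarrow> 'a) measure) X. prob_space \<nu> \<and>
           (\<forall>t\<in>{0..1}. X t \<in> \<nu> \<rightarrow>\<^sub>M restrict_space borel H) \<and>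
           distr \<nu> (restrict_space borel H) (X 0) = distr P (restrict_space borel H) f \<and>
           distr \<nu> (restrict_space borel H) (X 1) = distr P (restrict_space borel H) g \<and>
           (AE \<omega> in \<nu>. null_curve leq H (\<lambda>t. X t \<omega>)) \<and>
           (\<forall>t\<in>{0..1}. U_ent k (distr \<nu> (restrict_space borel H) (X t)) M \<ge>
              ennreal (1 - t) * U_ent k (distr P (restrict_space borel H) f) M +
              ennreal t * U_ent k (distr P (restrict_space borel H) g) M)))"

section \<open>From measures on the curve space to random variables\<close>

lemma measurable_eval_borel_curves:
  fixes H :: "'a::metric_space set"
  assumes t: "t \<in> {0..1}"
  shows "(\<lambda>\<gamma>. \<gamma> t) \<in> borel_curves H \<rightarrow>\<^sub>M restrict_space borel H"
proof (rule measurable_restrict_space2)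
  interpret C: Metric_space "mspace (curve_space H)" "mdist (curve_space H)"
    by (rule Metric_space_mspace_mdist)
  have sub: "{U. openin (mtopology_of (curve_space H)) U} \<subseteq> Pow (mspace (curve_space H))"
    using C.openin_mtopology by (auto simp: mtopology_of_def)
  have space: "space (borel_curves H) = mspace (curve_space H)"
    unfolding borel_curves_def by (rule space_measure_of[OF sub])
  have into: "\<gamma> t \<in> H" if "\<gamma> \<in> mspace (curve_space H)" for \<gamma>
    using that t by (auto simp: curve_space_def)
  then show "(\<lambda>\<gamma>. \<gamma> t) \<in> space (borel_curves H) \<rightarrow> H"
    by (auto simp: space)
  show "(\<lambda>\<gamma>. \<gamma> t) \<in> borel_measurable (borel_curves H)"
  proof (rule borel_measurableI)
    fix S :: "'a set" assume S: "open S"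
    let ?V = "(\<lambda>\<gamma>. \<gamma> t) -` S \<inter> mspace (curve_space H)"
    have "openin C.mtopology ?V"
      unfolding C.openin_mtopology
    proof (intro conjI allI impI)
      fix \<gamma> assume \<gamma>: "\<gamma> \<in> ?V"
      then obtain e where e: "e > 0" "ball (\<gamma> t) e \<subseteq> S"
        using S by (auto simp: open_contains_ball)
      \<comment> \<open>Evaluation at \<open>t\<close> does not increase distances, as the metric of
        the curve space is the uniform one.\<close>
      have "C.mball \<gamma> e \<subseteq> ?V"
      proof
        fix \<eta> assume \<eta>: "\<eta> \<in> C.mball \<gamma> e"
        then have "\<gamma> \<in> mspace (curve_space H)" "\<eta> \<in> mspace (curve_space H)"
          "mdist (curve_space H) \<gamma> \<eta> < e"
          by (auto simp: C.in_mball)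
        then have "dist (\<gamma> t) (\<eta> t) < e"
          using cfunspace_mdist_lt[of "top_of_set {0..1::real}" \<gamma> "submetric euclidean_metric H" \<eta> e t] t
          unfolding curve_space_def[symmetric] by (simp add: compactin_subtopology)
        then show "\<eta> \<in> ?V" using e \<eta> by auto
      qed
      then show "\<exists>r>0. C.mball \<gamma> r \<subseteq> ?V" using e by blast
    qed auto
    then have "?V \<in> sets (borel_curves H)"
      unfolding borel_curves_def sets_measure_of[OF sub] by (auto simp: mtopology_of_def)
    then show "(\<lambda>\<gamma>. \<gamma> t) -` S \<inter> space (borel_curves H) \<in> sets (borel_curves H)"
      by (simp add: space)
  qed
qed

lemma G_causal_curve_null_curve:
  assumes refl: "\<And>x. leq x x" and \<gamma>: "\<gamma> \<in> G_causal_curves leq H G"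
  shows "null_curve leq H \<gamma>"
proof -
  have mem: "\<gamma> \<in> mspace (curve_space H)" using \<gamma> by (simp add: G_causal_curves_def)
  then have cont: "continuous_on {0..1} \<gamma>" and img: "\<gamma> ` {0..1} \<subseteq> H"
    by (auto simp: curve_space_def mtopology_of_submetric continuous_map_in_subtopology)
  show ?thesis
  proof (cases "\<exists>x. \<forall>t\<in>{0..1}. \<gamma> t = x")
    case True
    then show ?thesis
      using cont img refl by (auto simp: null_curve_def causal_curve_on_def)
  next
    case False
    then show ?thesis
      using \<gamma> img by (auto simp: null_curve_def G_causal_curves_def)
  qed
qed

lemma measurable_Pair_restrict_borel:
  fixes H :: "'a::second_countable_topology set"
  assumes "f \<in> P \<rightarrow>\<^sub>M restrict_space borel H" "g \<in> P \<rightarrow>\<^sub>M restrict_space borel H"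
  shows "(\<lambda>z. (f z, g z)) \<in> P \<rightarrow>\<^sub>M restrict_space borel (H \<times> H)"
  using assms unfolding measurable_restrict_space2_iff
  by (auto simp: borel_prod[symmetric] Pi_iff)

lemma measurable_fst_snd_restrict_borel:
  fixes H :: "'a::second_countable_topology set"
  shows "fst \<in> restrict_space borel (H \<times> H) \<rightarrow>\<^sub>M restrict_space borel H"
    and "snd \<in> restrict_space borel (H \<times> H) \<rightarrow>\<^sub>M restrict_space borel H"
proof -
  have "fst \<in> borel_measurable (borel :: ('a \<times> 'a) measure)"
    and "snd \<in> borel_measurable (borel :: ('a \<times> 'a) measure)"
    unfolding borel_prod[symmetric] by measurable
  then show "fst \<in> restrict_space borel (H \<times> H) \<rightarrow>\<^sub>M restrict_space borel H"
    and "snd \<in> restrict_space borel (H \<times> H) \<rightarrow>\<^sub>M restrict_space borel H"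
    by (intro measurable_restrict_space2 measurable_restrict_space1; force simp: space_restrict_space)+
qed

text \<open>The joint law of \<open>f\<close> and \<open>g\<close> is a causal coupling of their
  laws. The energy condition applied to it gives a measure on curves, and the evaluations on the
  curve space serve as the random variables \<open>X t\<close>.\<close>

lemma NCe_imp_null_interpolation:
  fixes H :: "'a::polish_space set"
  assumes refl: "\<And>x. leq x x" and closed: "closed {(x, y). leq x y}" and H: "closed H"
    and NC: "NCe leq H G M N"
  shows "null_interpolation leq H M (N - 1)"
  unfolding null_interpolation_def
proof (intro allI impI, elim conjE)
  fix P :: "('a \<times> 'a) measure" and f g
  let ?R = "restrict_space borel H" and ?R2 = "restrict_space borel (H \<times> H)"
  assume P: "prob_space P" and f: "f \<in> P \<rightarrow>\<^sub>M ?R" and g: "g \<in> P \<rightarrow>\<^sub>M ?R"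
    and le: "AE z in P. leq (f z) (g z)"
  interpret P: prob_space P by fact
  note fg = measurable_Pair_restrict_borel[OF f g]
  define \<pi> where "\<pi> = distr P ?R2 (\<lambda>z. (f z, g z))"
  interpret \<pi>: prob_space \<pi> unfolding \<pi>_def by (rule P.prob_space_distr[OF fg])
  have eq: "{(x, y). x \<in> H \<and> y \<in> H \<and> leq x y} = (H \<times> H) \<inter> {(x, y). leq x y}" by auto
  have meas: "{(x, y). x \<in> H \<and> y \<in> H \<and> leq x y} \<in> sets ?R2"
    unfolding eq using closed by (auto simp: sets_restrict_space)
  have "emeasure \<pi> {(x, y). x \<in> H \<and> y \<in> H \<and> leq x y} =
      emeasure P ((\<lambda>z. (f z, g z)) -` {(x, y). x \<in> H \<and> y \<in> H \<and> leq x y} \<inter> space P)"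
    unfolding \<pi>_def by (rule emeasure_distr[OF fg meas])
  also have "\<dots> = 1"
  proof (rule P.emeasure_eq_1_AE[OF measurable_sets[OF fg meas]],
      use le AE_space in eventually_elim)
    fix z assume "leq (f z) (g z)" "z \<in> space P"
    then show "z \<in> (\<lambda>z. (f z, g z)) -` {(x, y). x \<in> H \<and> y \<in> H \<and> leq x y} \<inter> space P"
      using measurable_space[OF f] measurable_space[OF g] by (auto simp: space_restrict_space)
  qed
  finally have "emeasure \<pi> {(x, y). x \<in> H \<and> y \<in> H \<and> leq x y} = 1" .
  moreover have "distr \<pi> ?R fst = distr P ?R f" "distr \<pi> ?R snd = distr P ?R g"
    unfolding \<pi>_def
    by (subst distr_distr[OF measurable_fst_snd_restrict_borel(1) fg], simp add: comp_def)
       (subst distr_distr[OF measurable_fst_snd_restrict_borel(2) fg], simp add: comp_def)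
  ultimately have "\<pi> \<in> causal_couplings leq H (distr P ?R f) (distr P ?R g)"
    using \<pi>.prob_space_axioms by (simp add: causal_couplings_def borel_prob_on_def \<pi>_def)
  then obtain \<nu> where \<nu>: "\<nu> \<in> OptGeo leq H G (distr P ?R f) (distr P ?R g)"
    and U: "\<forall>t\<in>{0..1}. U_ent (N - 1) (marginal H \<nu> t) M \<ge>
             ennreal (1 - t) * U_ent (N - 1) (distr P ?R f) M + ennreal t * U_ent (N - 1) (distr P ?R g) M"
    using NC P.prob_space_distr[OF f] P.prob_space_distr[OF g]
    unfolding NCe_def borel_prob_on_def by (metis empty_iff sets_distr)
  then have \<nu>': "prob_space \<nu>" "sets \<nu> = sets (borel_curves H)"
    "distr \<nu> ?R (\<lambda>\<gamma>. \<gamma> 0) = distr P ?R f" "distr \<nu> ?R (\<lambda>\<gamma>. \<gamma> 1) = distr P ?R g"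
    and G: "AE \<gamma> in \<nu>. \<gamma> \<in> G_causal_curves leq H G"
    by (simp_all add: OptGeo_def marginal_def)
  have ev: "\<forall>t\<in>{0..1}. (\<lambda>\<gamma>. \<gamma> t) \<in> \<nu> \<rightarrow>\<^sub>M ?R"
    using measurable_eval_borel_curves[of _ H] unfolding measurable_cong_sets[OF \<nu>'(2) HOL.refl] by blast
  show "\<exists>(\<nu> :: (real \<Rightarrow> 'a) measure) X. prob_space \<nu> \<and> (\<forall>t\<in>{0..1}. X t \<in> \<nu> \<rightarrow>\<^sub>M ?R) \<and>
           distr \<nu> ?R (X 0) = distr P ?R f \<and> distr \<nu> ?R (X 1) = distr P ?R g \<and>
           (AE \<omega> in \<nu>. null_curve leq H (\<lambda>t. X t \<omega>)) \<and>
           (\<forall>t\<in>{0..1}. U_ent (N - 1) (distr \<nu> ?R (X t)) M \<ge>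
              ennreal (1 - t) * U_ent (N - 1) (distr P ?R f) M +
              ennreal t * U_ent (N - 1) (distr P ?R g) M)"
  proof (intro exI[of _ \<nu>] exI[of _ "\<lambda>t \<gamma>. \<gamma> t"] conjI)
    show "AE \<gamma> in \<nu>. null_curve leq H (\<lambda>t. \<gamma> t)"
      using G by eventually_elim (rule G_causal_curve_null_curve[OF refl])
  qed (use \<nu>' ev U[unfolded marginal_def] in simp_all)
qed

text \<open>A coupling and its interpolation live on different probability spaces and share only
  their marginals. This carries almost sure statements about the endpoints from one to the
  other.\<close>

lemma AE_cong_distr:
  assumes X: "X \<in> M \<rightarrow>\<^sub>M R" and Y: "Y \<in> N \<rightarrow>\<^sub>M R" and eq: "distr M R X = distr N R Y"
    and Q: "{x \<in> space R. Q x} \<in> sets R"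
  shows "(AE \<omega> in M. Q (X \<omega>)) \<longleftrightarrow> (AE \<omega> in N. Q (Y \<omega>))"
  unfolding AE_distr_iff[OF X Q, symmetric] AE_distr_iff[OF Y Q, symmetric] eq ..

section \<open>Time reversal\<close>

lemma inner_points_converse: "inner_points (\<lambda>x y. leq y x) H = inner_points leq H"
  by (auto simp: inner_points_def initial_points_def final_points_def)

lemma static_points_converse: "static_points (\<lambda>x y. leq y x) H = static_points leq H"
  by (auto simp: static_points_def initial_points_def final_points_def)

lemma initial_points_converse: "initial_points (\<lambda>x y. leq y x) H = final_points leq H"
  by (auto simp: initial_points_def final_points_def)

lemma null_curve_reverse:
  assumes "null_curve leq H \<gamma>"
  shows "null_curve (\<lambda>x y. leq y x) H (\<lambda>t. \<gamma> (1 - t))"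
proof -
  have 1: "(\<lambda>t::real. 1 - t) ` {0..1} = {0..1}" by simp
  have 2: "(\<lambda>t::real. 1 - t) ` {0<..<1} = {0<..<1}"
  proof (intro equalityI subsetI)
    show "t \<in> (\<lambda>t. 1 - t) ` {0<..<1}" if "t \<in> {0<..<1}" for t :: real
      using that by (intro image_eqI[of _ _ "1 - t"]) auto
  qed auto
  have "continuous_on {0..1} \<gamma>" using assms by (simp add: null_curve_def causal_curve_on_def)
  then have cont: "continuous_on {0..1} (\<lambda>t. \<gamma> (1 - t))"
    by (rule continuous_on_compose2[where f="\<lambda>t. 1 - t"]) (intro continuous_intros, simp)
  have le: "leq (\<gamma> (1 - t)) (\<gamma> (1 - s))" if "s \<in> {0..1}" "t \<in> {0..1}" "s \<le> t" for s t
    using assms that by (simp add: null_curve_def causal_curve_on_def)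
  have im1: "(\<lambda>t. \<gamma> (1 - t)) ` {0..1} = \<gamma> ` {0..1}"
    using arg_cong[OF 1, of "image \<gamma>"] by (simp only: image_image)
  have im2: "(\<lambda>t. \<gamma> (1 - t)) ` {0<..<1} = \<gamma> ` {0<..<1}"
    using arg_cong[OF 2, of "image \<gamma>"] by (simp only: image_image)
  show ?thesis
    unfolding null_curve_def inner_points_converse[of leq H] im1 im2
  proof (intro conjI impI)
    show "causal_curve_on (\<lambda>x y. leq y x) {0..1} (\<lambda>t. \<gamma> (1 - t))"
      unfolding causal_curve_on_def by (intro conjI ballI impI is_interval_cc cont le)
    show "\<gamma> ` {0..1} \<subseteq> H" using assms unfolding null_curve_def by blast
    assume "\<gamma> (1 - 0) \<noteq> \<gamma> (1 - 1)"
    then have "\<gamma> 0 \<noteq> \<gamma> 1" by (metis cancel_comm_monoid_add_class.diff_cancel diff_zero)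
    then show "\<gamma> ` {0<..<1} \<subseteq> inner_points leq H" using assms unfolding null_curve_def by blast
  qed
qed

lemma null_interpolation_converse:
  assumes "null_interpolation leq H M k"
  shows "null_interpolation (\<lambda>x y. leq y x) H M k"
  unfolding null_interpolation_def
proof (intro allI impI, elim conjE)
  fix P :: "('a \<times> 'a) measure" and f g
  let ?R = "restrict_space borel H"
  assume P: "prob_space P" "f \<in> P \<rightarrow>\<^sub>M ?R" "g \<in> P \<rightarrow>\<^sub>M ?R" "AE z in P. leq (g z) (f z)"
  obtain \<nu> :: "(real \<Rightarrow> 'a) measure" and X where X: "prob_space \<nu>"
    "\<forall>t\<in>{0..1}. X t \<in> \<nu> \<rightarrow>\<^sub>M ?R"
    "distr \<nu> ?R (X 0) = distr P ?R g" "distr \<nu> ?R (X 1) = distr P ?R f"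
    "AE \<omega> in \<nu>. null_curve leq H (\<lambda>t. X t \<omega>)"
    "\<forall>t\<in>{0..1}. U_ent k (distr \<nu> ?R (X t)) M \<ge>
       ennreal (1 - t) * U_ent k (distr P ?R g) M + ennreal t * U_ent k (distr P ?R f) M"
    using assms P unfolding null_interpolation_def by blast
  show "\<exists>(\<nu> :: (real \<Rightarrow> 'a) measure) X. prob_space \<nu> \<and> (\<forall>t\<in>{0..1}. X t \<in> \<nu> \<rightarrow>\<^sub>M ?R) \<and>
           distr \<nu> ?R (X 0) = distr P ?R f \<and> distr \<nu> ?R (X 1) = distr P ?R g \<and>
           (AE \<omega> in \<nu>. null_curve (\<lambda>x y. leq y x) H (\<lambda>t. X t \<omega>)) \<and>
           (\<forall>t\<in>{0..1}. U_ent k (distr \<nu> ?R (X t)) M \<ge>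
              ennreal (1 - t) * U_ent k (distr P ?R f) M + ennreal t * U_ent k (distr P ?R g) M)"
  proof (intro exI[of _ \<nu>] exI[of _ "\<lambda>t. X (1 - t)"] conjI ballI)
    show "AE \<omega> in \<nu>. null_curve (\<lambda>x y. leq y x) H (\<lambda>t. X (1 - t) \<omega>)"
      using X(5) by eventually_elim (rule null_curve_reverse)
    show "U_ent k (distr \<nu> ?R (X (1 - t))) M \<ge>
        ennreal (1 - t) * U_ent k (distr P ?R f) M + ennreal t * U_ent k (distr P ?R g) M"
      if "t \<in> {0..1}" for t
      using X(6)[rule_format, of "1 - t"] that by (simp add: add.commute)
  qed (use X in auto)
qed

text \<open>Neither a gauge nor the chronological relation occurs here, and every assumption
  survives the reversal of \<open>leq\<close>, so that what is proved inside is available in both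
  time directions.\<close>

locale null_flow =
  fixes leq :: "'a::polish_space \<Rightarrow> 'a \<Rightarrow> bool" and H :: "'a set" and M :: "'a measure" and k :: real
  assumes refl: "leq x x"
    and trans: "leq x y \<Longrightarrow> leq y z \<Longrightarrow> leq x z"
    and closed_leq: "closed {(x, y). leq x y}"
    and proper: "compact (cball (x :: 'a) r)"
    and closed_H: "closed H"
    and radon: "radon_measure_on H M"
    and static_null: "static_points leq H \<in> null_sets M"
    and k_pos: "k > 0"
    and interp: "null_interpolation leq H M k"
begin

abbreviation R :: "'a measure" where "R \<equiv> restrict_space borel H"

lemma converse: "null_flow (\<lambda>x y. leq y x) H M k"
proof
  have "{(x, y). leq y x} = prod.swap -` {(x, y). leq x y}" by auto
  moreover have "closed (prod.swap -` {(x, y). leq x y})"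
    by (intro closed_vimage closed_leq continuous_intros)
  ultimately show "closed {(x, y). leq y x}" by simp
qed (use refl trans proper closed_H radon static_null static_points_converse[of leq H] k_pos
    null_interpolation_converse[OF interp] in auto)

lemma H_borel [measurable]: "H \<in> sets borel"
  using closed_H by simp

lemma sets_M: "sets M = sets R"
  using radon by (simp add: radon_measure_on_def)

lemma sets_R_iff: "A \<in> sets R \<longleftrightarrow> A \<subseteq> H \<and> A \<in> sets borel"
  by (simp add: sets_restrict_space_iff)

text \<open>The definition of \<open>null_interpolation\<close> quantifies over couplings on one
  fixed type. Replacing \<open>f\<close> and \<open>g\<close> by the two projections under their
  joint law extends it to probability spaces of any type.\<close>

lemma interpolation:
  fixes P :: "'b measure"
  assumes P: "prob_space P" and f: "f \<in> P \<rightarrow>\<^sub>M R" and g: "g \<in> P \<rightarrow>\<^sub>M R"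
    and le: "AE z in P. leq (f z) (g z)"
  obtains \<nu> :: "(real \<Rightarrow> 'a) measure" and X where "prob_space \<nu>"
    "\<And>t. t \<in> {0..1} \<Longrightarrow> X t \<in> \<nu> \<rightarrow>\<^sub>M R"
    "distr \<nu> R (X 0) = distr P R f" "distr \<nu> R (X 1) = distr P R g"
    "AE \<omega> in \<nu>. null_curve leq H (\<lambda>t. X t \<omega>)"
    "\<And>t. t \<in> {0..1} \<Longrightarrow> U_ent k (distr \<nu> R (X t)) M \<ge>
       ennreal (1 - t) * U_ent k (distr P R f) M + ennreal t * U_ent k (distr P R g) M"
proof -
  let ?R2 = "restrict_space borel (H \<times> H)"
  note fg = measurable_Pair_restrict_borel[OF f g]
  let ?Q = "distr P ?R2 (\<lambda>z. (f z, g z))"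
  have 1: "prob_space ?Q" using P fg by (rule prob_space.prob_space_distr)
  have 2: "fst \<in> ?Q \<rightarrow>\<^sub>M R" "snd \<in> ?Q \<rightarrow>\<^sub>M R"
    using measurable_fst_snd_restrict_borel by simp_all
  have "{z \<in> space ?R2. leq (fst z) (snd z)} = (H \<times> H) \<inter> {(x, y). leq x y}"
    by (auto simp: space_restrict_space)
  then have "{z \<in> space ?R2. leq (fst z) (snd z)} \<in> sets ?R2"
    using closed_leq by (auto simp: sets_restrict_space)
  then have 3: "AE z in ?Q. leq (fst z) (snd z)"
    using le by (subst AE_distr_iff[OF fg]) auto
  have 4: "distr ?Q R fst = distr P R f" "distr ?Q R snd = distr P R g"
    by (subst distr_distr[OF measurable_fst_snd_restrict_borel(1) fg], simp add: comp_def)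
       (subst distr_distr[OF measurable_fst_snd_restrict_borel(2) fg], simp add: comp_def)
  have "\<exists>(\<nu> :: (real \<Rightarrow> 'a) measure) X. prob_space \<nu> \<and> (\<forall>t\<in>{0..1}. X t \<in> \<nu> \<rightarrow>\<^sub>M R) \<and>
           distr \<nu> R (X 0) = distr ?Q R fst \<and> distr \<nu> R (X 1) = distr ?Q R snd \<and>
           (AE \<omega> in \<nu>. null_curve leq H (\<lambda>t. X t \<omega>)) \<and>
           (\<forall>t\<in>{0..1}. U_ent k (distr \<nu> R (X t)) M \<ge>
              ennreal (1 - t) * U_ent k (distr ?Q R fst) M + ennreal t * U_ent k (distr ?Q R snd) M)"
    using interp[unfolded null_interpolation_def, rule_format, of ?Q fst snd] 1 2 3 by blast
  then show thesis unfolding 4 using that by blast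
qed

text \<open>Interpolate between the Dirac measures at \<open>p\<close> and \<open>q\<close>: almost
  every resulting path has the required properties, and an almost sure event of a probability space
  is nonempty.\<close>

lemma null_curve_exists:
  assumes pq: "p \<in> H" "q \<in> H" "leq p q"
  obtains \<gamma> where "null_curve leq H \<gamma>" "\<gamma> 0 = p" "\<gamma> 1 = q"
proof -
  let ?P = "return (count_space UNIV) (p, q)"
  have m: "(\<lambda>_. p) \<in> ?P \<rightarrow>\<^sub>M R" "(\<lambda>_. q) \<in> ?P \<rightarrow>\<^sub>M R" using pq by auto
  have P: "prob_space ?P" by (simp add: prob_space_return)
  have le: "AE z in ?P. leq p q" using pq by simp
  have sing: "{x \<in> space R. x = y} \<in> sets R" if "y \<in> H" for y
  proof -
    have "{x \<in> space R. x = y} = {y}" using that by auto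
    then show ?thesis using that by (simp add: sets_R_iff)
  qed
  obtain \<nu> :: "(real \<Rightarrow> 'a) measure" and X where X: "prob_space \<nu>" "\<And>t. t \<in> {0..1} \<Longrightarrow> X t \<in> \<nu> \<rightarrow>\<^sub>M R"
    "distr \<nu> R (X 0) = distr ?P R (\<lambda>_. p)" "distr \<nu> R (X 1) = distr ?P R (\<lambda>_. q)"
    "AE \<omega> in \<nu>. null_curve leq H (\<lambda>t. X t \<omega>)"
    "\<And>t. t \<in> {0..1} \<Longrightarrow> U_ent k (distr \<nu> R (X t)) M \<ge>
       ennreal (1 - t) * U_ent k (distr ?P R (\<lambda>_. p)) M + ennreal t * U_ent k (distr ?P R (\<lambda>_. q)) M"
    using interpolation[OF P m le] by blast
  have "AE \<omega> in \<nu>. X 0 \<omega> = p"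
    using AE_cong_distr[OF X(2) m(1) X(3) sing] pq by simp
  moreover have "AE \<omega> in \<nu>. X 1 \<omega> = q"
    using AE_cong_distr[OF X(2) m(2) X(4) sing] pq by simp
  ultimately have "AE \<omega> in \<nu>. null_curve leq H (\<lambda>t. X t \<omega>) \<and> X 0 \<omega> = p \<and> X 1 \<omega> = q"
    using X(5) by eventually_elim simp
  then obtain \<omega> where "null_curve leq H (\<lambda>t. X t \<omega>) \<and> X 0 \<omega> = p \<and> X 1 \<omega> = q"
    using prob_space.ae_filter_bot[OF X(1)] eventually_happens by blast
  then show thesis using that[of "\<lambda>t. X t \<omega>"] by simp
qed

lemma gauge_imp_antisym:
  assumes G: "null_gauge leq H G" and p: "p \<in> H" and q: "q \<in> H" and pq: "leq p q" and qp: "leq q p"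
  shows "p = q"
proof (rule ccontr)
  assume ne: "p \<noteq> q"
  have inner: "p \<in> inner_points leq H" "q \<in> inner_points leq H"
    using p q pq qp ne by (auto simp: inner_points_def initial_points_def final_points_def)
  obtain \<gamma> where \<gamma>: "null_curve leq H \<gamma>" "\<gamma> 0 = p" "\<gamma> 1 = q"
    using null_curve_exists[OF p q pq] by blast
  have "path \<gamma>" using \<gamma>(1) by (simp add: null_curve_def causal_curve_on_def path_def)
  then obtain \<alpha> where \<alpha>: "arc \<alpha>" "path_image \<alpha> \<subseteq> path_image \<gamma>" "\<alpha> 0 = p" "\<alpha> 1 = q"
    using path_contains_arc_metric[of \<gamma>] \<gamma> ne unfolding pathstart_def pathfinish_def by metis
  \<comment> \<open>Every point between \<open>p\<close> and \<open>q\<close> is equivalent to both, so \<open>\<alpha>\<close> is causal in both directions.\<close>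
  have img: "z \<in> inner_points leq H \<and> leq p z \<and> leq z q" if z: "z \<in> path_image \<gamma>" for z
  proof -
    obtain t where t: "t \<in> {0..1}" "z = \<gamma> t" using z by (auto simp: path_image_def)
    have "leq (\<gamma> 0) (\<gamma> t)" "leq (\<gamma> t) (\<gamma> 1)"
      using \<gamma>(1) t by (auto simp: null_curve_def causal_curve_on_def)
    moreover have "\<gamma> t \<in> inner_points leq H"
    proof (cases "t = 0 \<or> t = 1")
      case False
      then have "t \<in> {0<..<1}" using t by auto
      then show ?thesis using \<gamma> ne by (auto simp: null_curve_def)
    qed (use \<gamma> inner in auto)
    ultimately show ?thesis using t \<gamma> by simp
  qed
  have all: "leq y z" if "y \<in> path_image \<gamma>" "z \<in> path_image \<gamma>" for y z
    using img[OF that(1)] img[OF that(2)] qp trans by meson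
  have strict: "G (\<beta> 0) < G (\<beta> 1)" if \<beta>: "arc \<beta>" "path_image \<beta> \<subseteq> path_image \<gamma>" for \<beta>
  proof -
    have mem: "\<beta> s \<in> path_image \<gamma>" if "s \<in> {0..1}" for s
      using \<beta>(2) that by (auto simp: path_image_def)
    have "causal_curve_on leq {0..1} \<beta>"
      using \<beta>(1) mem all by (simp add: causal_curve_on_def is_interval_cc arc_def path_def)
    moreover have "\<beta> ` {0..1} \<subseteq> inner_points leq H" using mem img by blast
    ultimately have "strict_mono_on {0..1} (G \<circ> \<beta>)"
      using G \<beta>(1) by (simp add: null_gauge_def arc_def)
    then show ?thesis by (simp add: strict_mono_on_def)
  qed
  have "G p < G q" using strict[OF \<alpha>(1,2)] \<alpha> by simp
  moreover have "G q < G p"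
  proof -
    have "reversepath \<alpha> 0 = q" "reversepath \<alpha> 1 = p" using \<alpha> by (auto simp: reversepath_def)
    then show ?thesis using strict[of "reversepath \<alpha>"] \<alpha> by (simp add: arc_reversepath)
  qed
  ultimately show False by simp
qed

end

text \<open>Antisymmetry, a consequence of the gauge, is assumed in its place because it is
  unchanged when \<open>leq\<close> is reversed. Backward non-branching is the half that controls
  pasts.\<close>

locale nonbranching_null_flow = null_flow +
  assumes antisym: "x \<in> H \<Longrightarrow> y \<in> H \<Longrightarrow> leq x y \<Longrightarrow> leq y x \<Longrightarrow> x = y"
    and nonbranching: "backward_null_nonbranching leq H"
begin

text \<open>A causal curve may pause and so need not be injective. An arc extracted from its image
  lies in a chain, and \<open>arc_in_chain_mono\<close> shows that it is causal again.\<close>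

lemma causal_arc_exists:
  assumes pq: "p \<in> H" "q \<in> H" "leq p q" "p \<noteq> q"
  obtains \<alpha> where "arc \<alpha>" "path_image \<alpha> \<subseteq> H" "pathstart \<alpha> = p" "pathfinish \<alpha> = q"
    "\<And>s t. s \<in> {0..1} \<Longrightarrow> t \<in> {0..1} \<Longrightarrow> s \<le> t \<Longrightarrow> leq (\<alpha> s) (\<alpha> t)"
proof -
  obtain \<gamma> where \<gamma>: "null_curve leq H \<gamma>" "\<gamma> 0 = p" "\<gamma> 1 = q"
    using null_curve_exists pq by blast
  have mono: "leq (\<gamma> s) (\<gamma> t)" if "s \<in> {0..1}" "t \<in> {0..1}" "s \<le> t" for s t
    using \<gamma>(1) that by (auto simp: null_curve_def causal_curve_on_def)
  have H: "path_image \<gamma> \<subseteq> H" using \<gamma>(1) by (simp add: null_curve_def path_image_def)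
  have "path \<gamma>" using \<gamma>(1) by (simp add: null_curve_def causal_curve_on_def path_def)
  then obtain \<alpha> where \<alpha>: "arc \<alpha>" "path_image \<alpha> \<subseteq> path_image \<gamma>" "pathstart \<alpha> = p" "pathfinish \<alpha> = q"
    using path_contains_arc_metric[of \<gamma>] \<gamma> pq unfolding pathstart_def pathfinish_def by metis
  have total: "leq x y \<or> leq y x" if xy: "x \<in> path_image \<gamma>" "y \<in> path_image \<gamma>" for x y
  proof -
    obtain s t where "s \<in> {0..1}" "t \<in> {0..1}" "x = \<gamma> s" "y = \<gamma> t"
      using xy by (auto simp: path_image_def)
    then show ?thesis using mono[of s t] mono[of t s] by (metis linear)
  qed
  have start: "leq p x" if "x \<in> path_image \<gamma>" for x
    using that mono[of 0] \<gamma>(2) by (auto simp: path_image_def)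
  have "leq (\<alpha> s) (\<alpha> t)" if "s \<in> {0..1}" "t \<in> {0..1}" "s \<le> t" for s t
  proof (rule arc_in_chain_mono[OF \<alpha>(1) closed_leq])
    show "leq x y \<or> leq y x" if "x \<in> path_image \<alpha>" "y \<in> path_image \<alpha>" for x y
      using total that \<alpha>(2) by blast
    show "x = y" if "x \<in> path_image \<alpha>" "y \<in> path_image \<alpha>" "leq x y" "leq y x" for x y
      using antisym that \<alpha>(2) H by blast
    show "leq (pathstart \<alpha>) x" if "x \<in> path_image \<alpha>" for x
      using start that \<alpha> by blast
  qed fact+
  then show thesis using that \<alpha> H by blast
qed

text \<open>Two causal arcs ending in the inner point \<open>y\<close> can be prolonged by a common arc, so backward
  non-branching makes them comparable; hence the past of \<open>y\<close> lies on one arc.\<close>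

lemma bounded_past:
  assumes x: "x \<in> initial_points leq H" and y: "y \<in> inner_points leq H" and xy: "leq x y"
  shows "bounded {p \<in> H. leq p y}"
proof -
  have yH: "y \<in> H" and xH: "x \<in> H" using x y by (auto simp: inner_points_def initial_points_def)
  have xy_ne: "x \<noteq> y" using x y by (auto simp: inner_points_def)
  obtain z where z: "z \<in> H" "leq y z" "y \<noteq> z"
    using y by (auto simp: inner_points_def final_points_def)
  obtain \<sigma> where \<sigma>: "arc \<sigma>" "path_image \<sigma> \<subseteq> H" "pathstart \<sigma> = y" "pathfinish \<sigma> = z"
    and \<sigma>_mono: "\<And>s t. s \<in> {0..1} \<Longrightarrow> t \<in> {0..1} \<Longrightarrow> s \<le> t \<Longrightarrow> leq (\<sigma> s) (\<sigma> t)"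
    using causal_arc_exists[OF yH z] by blast
  have \<sigma>_ge: "leq y w" if "w \<in> path_image \<sigma>" for w
    using that \<sigma>_mono[of 0] \<sigma>(3) by (auto simp: path_image_def pathstart_def)
  \<comment> \<open>The curve \<delta> runs backwards from \<open>z\<close> along \<sigma>, reaches
    \<open>y\<close> at time 1/2 and continues down to \<open>p\<close>. Any two such curves
    therefore agree at times 0 and 1/2, as the definition of non-branching demands.\<close>
  have ext: "\<exists>\<delta>. causal_curve_on (\<lambda>x y. leq y x) {0..1} \<delta> \<and> inj_on \<delta> {0..1} \<and> \<delta> ` {0..1} \<subseteq> H \<and>
      \<delta> 0 = z \<and> \<delta> (1/2) = y \<and> p \<in> \<delta> ` {0..1} \<and> compact (\<delta> ` {0..1}) \<and> (\<forall>w\<in>\<delta> ` {0..1}. leq p w)"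
    if p: "p \<in> H" "leq p y" "p \<noteq> y" for p
  proof -
    obtain \<eta> where \<eta>: "arc \<eta>" "path_image \<eta> \<subseteq> H" "pathstart \<eta> = p" "pathfinish \<eta> = y"
      and \<eta>_mono: "\<And>s t. s \<in> {0..1} \<Longrightarrow> t \<in> {0..1} \<Longrightarrow> s \<le> t \<Longrightarrow> leq (\<eta> s) (\<eta> t)"
      using causal_arc_exists[OF p(1) yH p(2,3)] by blast
    have \<eta>_le: "leq w y" if "w \<in> path_image \<eta>" for w
      using that \<eta>_mono[of _ 1] \<eta>(4) by (auto simp: path_image_def pathfinish_def)
    \<comment> \<open>All of \<eta> lies below \<open>y\<close> and all of \<sigma> above it, so by
      antisymmetry they meet only in \<open>y\<close>.\<close>
    have "path_image \<eta> \<inter> path_image \<sigma> \<subseteq> {pathstart \<sigma>}"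
      using antisym yH \<eta>_le \<sigma>_ge \<eta>(2) \<sigma>(3) by blast
    then have arc: "arc (\<eta> +++ \<sigma>)"
      using \<eta> \<sigma> by (intro arc_join) auto
    have mono: "leq ((\<eta> +++ \<sigma>) s) ((\<eta> +++ \<sigma>) t)" if st: "s \<in> {0..1}" "t \<in> {0..1}" "s \<le> t" for s t
    proof -
      consider "t \<le> 1/2" | "s \<le> 1/2" "t > 1/2" | "s > 1/2" using st by linarith
      then show ?thesis
      proof cases
        case 2
        then have "leq (\<eta> (2 * s)) y" "leq y (\<sigma> (2 * t - 1))"
          using st by (auto intro!: \<eta>_le \<sigma>_ge simp: path_image_def)
        then show ?thesis using 2 trans by (auto simp: joinpaths_def)
      qed (use st \<eta>_mono \<sigma>_mono in \<open>auto simp: joinpaths_def\<close>)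
    qed
    define \<delta> where "\<delta> = reversepath (\<eta> +++ \<sigma>)"
    have im: "\<delta> ` {0..1} = path_image \<eta> \<union> path_image \<sigma>"
      using path_image_join[of \<eta> \<sigma>] \<eta> \<sigma> path_image_reversepath[of "\<eta> +++ \<sigma>"]
      by (simp add: \<delta>_def path_image_def)
    have arc': "arc \<delta>" using arc by (simp add: \<delta>_def arc_reversepath)
    have "causal_curve_on (\<lambda>x y. leq y x) {0..1} \<delta>"
      using arc' mono by (auto simp: causal_curve_on_def is_interval_cc arc_def path_def \<delta>_def reversepath_def)
    moreover have "inj_on \<delta> {0..1}" using arc' by (simp add: arc_def)
    moreover have "\<delta> ` {0..1} \<subseteq> H" using im \<eta> \<sigma> by simp
    moreover have "\<delta> 0 = z" "\<delta> (1/2) = y"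
      using \<sigma> \<eta> by (auto simp: \<delta>_def reversepath_def joinpaths_def pathfinish_def)
    moreover have "p \<in> \<delta> ` {0..1}" using im \<eta>(3) by (metis UnI1 pathstart_in_path_image)
    moreover have "compact (\<delta> ` {0..1})"
      using arc' compact_arc_image[of \<delta>] by (simp add: path_image_def)
    moreover have "\<forall>w\<in>\<delta> ` {0..1}. leq p w"
    proof
      fix w assume "w \<in> \<delta> ` {0..1}"
      then consider "w \<in> path_image \<eta>" | "w \<in> path_image \<sigma>" using im by blast
      then show "leq p w"
      proof cases
        case 1
        then show ?thesis using \<eta>_mono[of 0] \<eta>(3) by (auto simp: path_image_def pathstart_def)
      next
        case 2
        then show ?thesis using \<sigma>_ge p(2) trans by blast
      qed
    qed
    ultimately show ?thesis by blast
  qed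
  \<comment> \<open>The reference curve is the one that descends to the initial point
    \<open>x\<close>.\<close>
  obtain \<delta> where \<delta>: "causal_curve_on (\<lambda>x y. leq y x) {0..1} \<delta>" "inj_on \<delta> {0..1}" "\<delta> ` {0..1} \<subseteq> H"
      "\<delta> 0 = z" "\<delta> (1/2) = y" "x \<in> \<delta> ` {0..1}" "compact (\<delta> ` {0..1})"
    using ext[OF xH xy xy_ne] by blast
  have "p \<in> \<delta> ` {0..1}" if p: "p \<in> H" "leq p y" for p
  proof (cases "p = y")
    case True
    then show ?thesis using \<delta>(5) by force
  next
    case False
    obtain \<epsilon> where \<epsilon>: "causal_curve_on (\<lambda>x y. leq y x) {0..1} \<epsilon>" "inj_on \<epsilon> {0..1}" "\<epsilon> ` {0..1} \<subseteq> H"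
      "\<epsilon> 0 = z" "\<epsilon> (1/2) = y" "p \<in> \<epsilon> ` {0..1}" "\<forall>w\<in>\<epsilon> ` {0..1}. leq p w"
      using ext[OF p False] by blast
    have "\<epsilon> ` {0..1} \<subseteq> \<delta> ` {0..1} \<or> \<delta> ` {0..1} \<subseteq> \<epsilon> ` {0..1}"
      using nonbranching \<delta> \<epsilon> unfolding backward_null_nonbranching_def forward_null_nonbranching_def
      by metis
    then show ?thesis
    proof
      \<comment> \<open>In this direction the inclusion puts \<open>x\<close> on the curve through
        \<open>p\<close>, hence above \<open>p\<close>; as \<open>x\<close> is initial, the two
        points coincide.\<close>
      assume "\<delta> ` {0..1} \<subseteq> \<epsilon> ` {0..1}"
      then have "leq p x" using \<epsilon>(7) \<delta>(6) by blast
      then have "p = x" using x p by (auto simp: initial_points_def)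
      then show ?thesis using \<delta>(6) by simp
    qed (use \<epsilon> in blast)
  qed
  then have "{p \<in> H. leq p y} \<subseteq> \<delta> ` {0..1}" by blast
  then show ?thesis using \<delta>(7) compact_imp_bounded bounded_subset by blast
qed

end

section \<open>Entropy near initial points\<close>

context null_flow
begin

text \<open>Projections of Borel sets need not be Borel, but this set is \<sigma>-compact: bounding
  both coordinates and replacing \<open>f z > 0\<close> by \<open>f z \<ge> 1 / (n + 1)\<close>
  exhausts it by compact sets, whose projections are compact.\<close>

lemma projection_borel:
  fixes F :: "('a \<times> 'a) set" and f :: "'a \<times> 'a \<Rightarrow> real"
  assumes F: "closed F" and f: "continuous_on UNIV f"
  shows "snd ` {z \<in> F. f z > 0} \<in> sets borel"
proof -
  fix x0 :: 'a
  define D where "D n = (cball x0 (real n) \<times> cball x0 (real n)) \<inter> (F \<inter> {z. 1 / (real n + 1) \<le> f z})" for n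
  have "compact (D n)" for n
    unfolding D_def by (intro compact_Int_closed compact_Times proper closed_Int F closed_Collect_le f continuous_intros)
  then have "snd ` D n \<in> sets borel" for n
    by (intro borel_compact compact_continuous_image continuous_intros)
  moreover have "snd ` {z \<in> F. f z > 0} = (\<Union>n. snd ` D n)"
  proof -
    have "\<exists>n. z \<in> D n" if z: "z \<in> F" "f z > 0" for z
    proof -
      obtain i where i: "1 / (real i + 1) < f z"
        using z(2) by (metis add.commute inverse_eq_divide of_nat_Suc reals_Archimedean)
      define n where "n = max i (nat \<lceil>max (dist x0 (fst z)) (dist x0 (snd z))\<rceil>)"
      have "dist x0 (fst z) \<le> real n" "dist x0 (snd z) \<le> real n"
        unfolding n_def by linarith+
      moreover have "1 / (real n + 1) \<le> 1 / (real i + 1)"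
        unfolding n_def by (intro divide_left_mono) auto
      ultimately show ?thesis
        using z i by (intro exI[of _ n]) (auto simp: D_def mem_Times_iff)
    qed
    moreover have "z \<in> F \<and> f z > 0" if "z \<in> D n" for z n
    proof -
      have "0 < 1 / (real n + 1)" by simp
      also have "\<dots> \<le> f z" using that by (simp add: D_def)
      finally show ?thesis using that by (simp add: D_def)
    qed
    ultimately have "{z \<in> F. f z > 0} = (\<Union>n. D n)" by auto
    then show ?thesis by (simp only: image_UN)
  qed
  ultimately show ?thesis by auto
qed

lemma closed_causal_pairs: "closed {(x, y). x \<in> H \<and> y \<in> H \<and> leq x y}"
proof -
  have "{(x, y). x \<in> H \<and> y \<in> H \<and> leq x y} = (H \<times> H) \<inter> {(x, y). leq x y}" by auto
  then show ?thesis using closed_H closed_leq by (simp add: closed_Times closed_Int)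
qed

lemma initial_points_borel: "initial_points leq H \<in> sets borel"
proof -
  let ?S = "snd ` {z \<in> {(x, y). x \<in> H \<and> y \<in> H \<and> leq x y}. dist (fst z) (snd z) > 0}"
  have "?S \<in> sets borel"
    by (intro projection_borel closed_causal_pairs continuous_intros)
  moreover have "initial_points leq H = H - ?S"
    by (force simp: initial_points_def)
  ultimately show ?thesis by auto
qed

lemma final_points_borel: "final_points leq H \<in> sets borel"
  using null_flow.initial_points_borel[OF converse] unfolding initial_points_converse .

lemma inner_points_borel: "inner_points leq H \<in> sets borel"
  unfolding inner_points_def using initial_points_borel final_points_borel by auto

lemma bounded_past_borel: "{y \<in> H. \<forall>p\<in>H. leq p y \<longrightarrow> p \<in> cball x0 r} \<in> sets borel"
proof -
  let ?S = "snd ` {z \<in> {(x, y). x \<in> H \<and> y \<in> H \<and> leq x y}. dist x0 (fst z) - r > 0}"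
  have "?S \<in> sets borel"
    by (intro projection_borel closed_causal_pairs continuous_intros)
  moreover have "{y \<in> H. \<forall>p\<in>H. leq p y \<longrightarrow> p \<in> cball x0 r} = H - ?S"
    by (force simp: not_le)
  ultimately show ?thesis by auto
qed

lemma emeasure_compact_finite: "compact K \<Longrightarrow> K \<subseteq> H \<Longrightarrow> emeasure M K < \<infinity>"
  using radon by (simp add: radon_measure_on_def)

text \<open>Continuity from above inside \<open>B\<close>, which has finite measure: the punctured
  neighbourhoods decrease to the empty set because points at distance 0 from \<open>K\<close> are
  excluded.\<close>

lemma measure_punctured_neighbourhood:
  assumes K: "compact K" "K \<noteq> {}" and B: "compact B" "B \<subseteq> H" and e: "e > 0"
  obtains \<delta> where "\<delta> > 0" "measure M {x \<in> B. 0 < infdist x K \<and> infdist x K < \<delta>} < e"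
proof -
  define A where "A j = {x \<in> B. 0 < infdist x K \<and> infdist x K < 1 / (real j + 1)}" for j
  have "B \<in> sets borel" using B by (simp add: borel_compact)
  moreover have "{x. 0 < infdist x K \<and> infdist x K < 1 / (real j + 1)} \<in> sets borel" for j
    by (intro borel_open open_Collect_conj open_Collect_less continuous_intros)
  ultimately have "B \<inter> {x. 0 < infdist x K \<and> infdist x K < 1 / (real j + 1)} \<in> sets borel" for j
    by (rule sets.Int)
  then have Ab: "A j \<in> sets borel" for j
    by (simp add: A_def Int_def)
  have sub: "A j \<subseteq> B" for j by (auto simp: A_def)
  have A: "A j \<in> sets M" for j
    using Ab sub B by (auto simp: sets_M sets_R_iff)
  have BM: "B \<in> sets M" using B by (simp add: sets_M sets_R_iff borel_compact)
  have fin: "emeasure M (A j) \<noteq> \<infinity>" for j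
    using emeasure_mono[OF sub BM, of j] emeasure_compact_finite[OF B] by (auto simp: top_unique)
  have "decseq A"
  proof (unfold decseq_def, intro allI impI subsetI)
    fix m n :: nat and x assume "m \<le> n" "x \<in> A n"
    moreover from \<open>m \<le> n\<close> have "1 / (real n + 1) \<le> 1 / (real m + 1)" by (intro divide_left_mono) auto
    ultimately show "x \<in> A m" by (auto simp: A_def)
  qed
  then have "(\<lambda>j. emeasure M (A j)) \<longlonglongrightarrow> emeasure M (\<Inter>j. A j)"
    using A fin by (intro Lim_emeasure_decseq) auto
  moreover have "(\<Inter>j. A j) = {}"
  proof (rule ccontr)
    assume "(\<Inter>j. A j) \<noteq> {}"
    then obtain x where x: "\<And>j. x \<in> A j" by blast
    then have "0 < infdist x K" by (auto simp: A_def)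
    then obtain j where "1 / (real j + 1) < infdist x K"
      by (metis add.commute inverse_eq_divide of_nat_Suc reals_Archimedean)
    then show False using x[of j] by (auto simp: A_def)
  qed
  ultimately have "(\<lambda>j. emeasure M (A j)) \<longlonglongrightarrow> 0" by simp
  then have "\<forall>\<^sub>F j in sequentially. emeasure M (A j) < ennreal e"
    by (rule order_tendstoD(2)) (use e in simp)
  then obtain j where "emeasure M (A j) < ennreal e"
    using eventually_happens trivial_limit_sequentially by blast
  then have "measure M (A j) < e"
    using fin[of j] by (simp add: emeasure_eq_ennreal_measure ennreal_less_iff)
  then show thesis
    using that[of "1 / (real j + 1)"] by (simp add: A_def)
qed

text \<open>Mass that leaves \<open>K\<close> at once is squeezed, for small times, into a punctured neighbourhood of
  \<open>K\<close>, whose measure is small.\<close>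

lemma Ent_blow_up:
  fixes X :: "real \<Rightarrow> 'b \<Rightarrow> 'a"
  assumes \<nu>: "prob_space \<nu>" and X: "\<And>t. t \<in> {0..1} \<Longrightarrow> X t \<in> \<nu> \<rightarrow>\<^sub>M R"
    and K: "compact K" and B: "compact B" "B \<subseteq> H"
    and cont: "AE \<omega> in \<nu>. continuous_on {0..1} (\<lambda>t. X t \<omega>)"
    and start: "AE \<omega> in \<nu>. X 0 \<omega> \<in> K"
    and leave: "AE \<omega> in \<nu>. \<forall>t\<in>{0<..<1}. X t \<omega> \<in> B - K"
  shows "\<exists>t\<in>{0<..<1/2}. Ent (distr \<nu> R (X t)) M > ereal E"
proof -
  interpret \<nu>: prob_space \<nu> by fact
  have "K \<noteq> {}"
    using start \<nu>.ae_filter_bot by (metis (mono_tags, lifting) empty_iff eventually_happens)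
  \<comment> \<open>In \<open>Ent_lower_bound\<close> at most 3 is lost from \<open>a\<close>: at
    most 1 through the exceptional event, whose probability is weighted by \<open>a + b\<close>, and
    at most 1 through each of the two exponential terms. This leaves at least
    \<open>\<bar>E\<bar> + 1\<close>.\<close>
  define a where "a = \<bar>E\<bar> + 4"
  define b where "b = measure M B"
  have ab: "a \<ge> 0" "b \<ge> 0" by (auto simp: a_def b_def)
  obtain \<delta> where \<delta>: "\<delta> > 0" "measure M {x \<in> B. 0 < infdist x K \<and> infdist x K < \<delta>} < exp (1 - a)"
    using measure_punctured_neighbourhood[OF K \<open>K \<noteq> {}\<close> B] by (metis exp_gt_zero)
  define A where "A = {x \<in> B. 0 < infdist x K \<and> infdist x K < \<delta>}"
  have "B \<inter> {x. 0 < infdist x K \<and> infdist x K < \<delta>} \<in> sets borel"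
    using B by (intro sets.Int borel_compact borel_open open_Collect_conj open_Collect_less continuous_intros)
  then have Ab: "A \<in> sets borel" by (simp add: A_def Int_def)
  have "A \<subseteq> B" by (auto simp: A_def)
  then have A: "A \<in> sets R" and BR: "B \<in> sets R"
    using Ab B by (auto simp: sets_R_iff borel_compact)
  \<comment> \<open>The shift by 2 puts all these times below 1/2.\<close>
  define t :: "nat \<Rightarrow> real" where "t i = inverse (real (Suc (i + 2)))" for i
  have t: "t i \<in> {0<..<1/2}" for i by (auto simp: t_def field_simps)
  have t1: "t i \<in> {0..1}" "t i \<in> {0<..<1}" for i
    by (auto simp: t_def field_simps)
  have t0: "t \<longlonglongrightarrow> 0"
    unfolding t_def by (rule LIMSEQ_ignore_initial_segment[OF LIMSEQ_inverse_real_of_nat])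
  define D where "D i = {\<omega> \<in> space \<nu>. X (t i) \<omega> \<notin> A}" for i
  have Deq: "D i = space \<nu> - (X (t i) -` A \<inter> space \<nu>)" for i by (auto simp: D_def)
  have D[measurable]: "D i \<in> sets \<nu>" for i
    unfolding Deq using measurable_sets[OF X[OF t1(1)] A] by auto
  \<comment> \<open>Path by path the exceptional event eventually stops occurring: at small times
    the path is close to \<open>K\<close> by continuity, yet off \<open>K\<close> by
    \<open>leave\<close>. Dominated convergence then sends the probabilities of \<open>D i\<close>
    to 0.\<close>
  have lim: "AE \<omega> in \<nu>. (\<lambda>i. indicator (D i) \<omega> :: real) \<longlonglongrightarrow> 0"
    using cont start leave
  proof eventually_elim
    fix \<omega> assume c: "continuous_on {0..1} (\<lambda>t. X t \<omega>)" and s: "X 0 \<omega> \<in> K"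
      and l: "\<forall>t\<in>{0<..<1}. X t \<omega> \<in> B - K"
    have "(\<lambda>i. X (t i) \<omega>) \<longlonglongrightarrow> X 0 \<omega>"
      by (rule continuous_on_tendsto_compose[OF c t0]) (use t1 in auto)
    then have "(\<lambda>i. infdist (X (t i) \<omega>) K) \<longlonglongrightarrow> infdist (X 0 \<omega>) K"
      by (intro tendsto_intros)
    then have "\<forall>\<^sub>F i in sequentially. infdist (X (t i) \<omega>) K < \<delta>"
      using s \<delta>(1) by (auto dest: order_tendstoD(2))
    then have "\<forall>\<^sub>F i in sequentially. indicator (D i) \<omega> = (0::real)"
    proof eventually_elim
      fix i assume "infdist (X (t i) \<omega>) K < \<delta>"
      moreover have "X (t i) \<omega> \<in> B - K" using l t1 by blast
      then have "0 < infdist (X (t i) \<omega>) K"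
        using K \<open>K \<noteq> {}\<close> by (intro infdist_pos_not_in_closed compact_imp_closed) auto
      ultimately have "X (t i) \<omega> \<in> A"
        using \<open>X (t i) \<omega> \<in> B - K\<close> by (simp add: A_def)
      then show "indicator (D i) \<omega> = (0::real)" by (simp add: D_def)
    qed
    then show "(\<lambda>i. indicator (D i) \<omega> :: real) \<longlonglongrightarrow> 0" by (rule tendsto_eventually)
  qed
  have "(\<lambda>i. LINT \<omega>|\<nu>. indicator (D i) \<omega>) \<longlonglongrightarrow> (LINT \<omega>|\<nu>. (0::real))"
    by (rule integral_dominated_convergence[where w="\<lambda>_. 1"]) (use lim in \<open>auto simp: indicator_def\<close>)
  then have "(\<lambda>i. \<nu>.prob (D i)) \<longlonglongrightarrow> 0"
    by simp
  moreover have "1 / (a + b + 1) > 0" using ab by simp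
  ultimately have "\<forall>\<^sub>F i in sequentially. \<nu>.prob (D i) < 1 / (a + b + 1)"
    by (rule order_tendstoD(2))
  then obtain i where i: "\<nu>.prob (D i) < 1 / (a + b + 1)"
    using eventually_happens trivial_limit_sequentially by blast
  define \<mu> where "\<mu> = distr \<nu> R (X (t i))"
  have Xm: "X (t i) \<in> \<nu> \<rightarrow>\<^sub>M R" using X t1 by blast
  interpret \<mu>: prob_space \<mu> unfolding \<mu>_def by (rule \<nu>.prob_space_distr[OF Xm])
  have \<mu>A: "measure \<mu> A = 1 - \<nu>.prob (D i)"
  proof -
    have "measure \<mu> A = \<nu>.prob (X (t i) -` A \<inter> space \<nu>)"
      unfolding \<mu>_def by (rule measure_distr[OF Xm A])
    also have "X (t i) -` A \<inter> space \<nu> = space \<nu> - D i" by (auto simp: D_def)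
    finally show ?thesis by (simp add: \<nu>.prob_compl[OF D])
  qed
  have \<mu>B: "measure \<mu> (B - A) \<le> \<nu>.prob (D i)"
  proof -
    have "measure \<mu> (B - A) \<le> measure \<mu> (space \<mu> - A)"
      using sets.compl_sets[OF A] sets.sets_into_space[OF BR]
      by (intro \<mu>.finite_measure_mono) (auto simp: \<mu>_def)
    also have "\<dots> = \<nu>.prob (D i)" using A \<mu>A by (subst \<mu>.prob_compl) (auto simp: \<mu>_def)
    finally show ?thesis .
  qed
  have conc: "AE x in \<mu>. x \<in> A \<union> (B - A)"
  proof -
    have "AE \<omega> in \<nu>. X (t i) \<omega> \<in> B"
      using leave by eventually_elim (use t1 in blast)
    moreover have "{x \<in> space R. x \<in> B} = B" using sets.sets_into_space[OF BR] by auto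
    ultimately have "AE x in \<mu>. x \<in> B"
      unfolding \<mu>_def using BR by (subst AE_distr_iff[OF Xm]) auto
    then show ?thesis by eventually_elim auto
  qed
  have fB: "emeasure M B < \<infinity>" using emeasure_compact_finite[OF B] .
  have "emeasure M A \<le> emeasure M B" "emeasure M (B - A) \<le> emeasure M B"
    using \<open>A \<subseteq> B\<close> BR by (auto intro!: emeasure_mono simp: sets_M)
  then have fin: "emeasure M A < \<infinity>" "emeasure M (B - A) < \<infinity>"
    using fB by (auto intro: le_less_trans)
  have mB: "measure M (B - A) \<le> b"
    unfolding b_def using BR fB by (intro measure_mono_fmeasurable) (auto simp: sets_M A fmeasurable_def)
  have "exp (- b - 1) * measure M (B - A) \<le> exp (- b - 1) * b"
    using mB by simp
  also have "\<dots> \<le> exp (- b - 1) * exp (b + 1)"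
    using exp_ge_add_one_self[of "b + 1"] by (intro mult_left_mono) auto
  also have "\<dots> = 1" by (simp flip: exp_add)
  finally have 1: "exp (- b - 1) * measure M (B - A) \<le> 1" .
  have 2: "exp (a - 1) * measure M A \<le> 1"
  proof -
    have "exp (a - 1) * measure M A \<le> exp (a - 1) * exp (1 - a)"
      using \<delta>(2) by (intro mult_left_mono) (auto simp: A_def)
    then show ?thesis by (simp flip: exp_add)
  qed
  have "(a + b) * \<nu>.prob (D i) \<le> 1"
  proof -
    have "(a + b) * \<nu>.prob (D i) \<le> (a + b + 1) * (1 / (a + b + 1))"
      using i ab by (intro mult_mono) auto
    then show ?thesis using ab by simp
  qed
  moreover have "b * measure \<mu> (B - A) \<le> b * \<nu>.prob (D i)"
    using \<mu>B ab by (intro mult_left_mono)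
  ultimately have "E < a * measure \<mu> A - b * measure \<mu> (B - A)
           - exp (a - 1) * measure M A - exp (- b - 1) * measure M (B - A)"
    using 1 2 unfolding \<mu>A by (simp add: a_def algebra_simps)
  also have "ereal \<dots> \<le> Ent \<mu> M"
    using A BR fin conc ab by (intro Ent_lower_bound \<mu>.prob_space_axioms) (auto simp: sets_M \<mu>_def)
  finally have "ereal E < Ent \<mu> M" by simp
  then show ?thesis using t unfolding \<mu>_def by blast
qed

end

section \<open>The contradiction from initial points of positive measure\<close>

context nonbranching_null_flow
begin

lemma initial_points_sets: "initial_points leq H \<in> sets M"
  using initial_points_borel by (auto simp: sets_M sets_R_iff initial_points_def)

text \<open>The causal pairs of distinct points are exhausted by compact relations
  \<open>C n\<close>; the lower bound on the distance keeps them closed and off the diagonal. The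
  domains of the \<open>C n\<close> cover all non-static initial points, so one of them meets the
  initial points in positive measure. Inner regularity yields \<open>K\<close>, and a selection of
  \<open>C n\<close> yields \<open>T\<close>.\<close>

lemma compact_positive_initial_points:
  assumes "initial_points leq H \<notin> null_sets M"
  obtains K and T :: "'a \<Rightarrow> 'a" where "compact K" "K \<subseteq> initial_points leq H" "emeasure M K \<noteq> 0"
    "T \<in> borel \<rightarrow>\<^sub>M borel" "\<And>x. x \<in> K \<Longrightarrow> T x \<in> H \<and> leq x (T x) \<and> T x \<noteq> x"
proof -
  fix x0 :: 'a
  let ?a = "initial_points leq H"
  define C where "C n = (cball x0 (real n) \<times> cball x0 (real n)) \<inter>
     ({(x, y). x \<in> H \<and> y \<in> H \<and> leq x y} \<inter> {z. 1 / (real n + 1) \<le> dist (fst z) (snd z)})" for n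
  have C: "compact (C n)" for n
    unfolding C_def
    by (intro compact_Int_closed compact_Times proper closed_Int closed_causal_pairs closed_Collect_le continuous_intros)
  have fstC: "fst ` C n \<in> sets M" for n
  proof -
    have "fst ` C n \<in> sets borel" by (intro borel_compact compact_continuous_image C continuous_intros)
    then show ?thesis by (auto simp: sets_M sets_R_iff C_def)
  qed
  have cover: "\<exists>n. x \<in> fst ` C n" if x: "x \<in> ?a" "x \<notin> static_points leq H" for x
  proof -
    obtain y where y: "x \<in> H" "y \<in> H" "leq x y" "y \<noteq> x"
      using x by (auto simp: static_points_def initial_points_def final_points_def)
    obtain i where i: "1 / (real i + 1) < dist x y"
      using y(4) by (metis add.commute inverse_eq_divide of_nat_Suc reals_Archimedean zero_less_dist_iff)
    define n where "n = max i (nat \<lceil>max (dist x0 x) (dist x0 y)\<rceil>)"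
    have "dist x0 x \<le> real n" "dist x0 y \<le> real n"
      unfolding n_def by linarith+
    moreover have "1 / (real n + 1) \<le> 1 / (real i + 1)"
      unfolding n_def by (intro divide_left_mono) auto
    ultimately have "(x, y) \<in> C n" using y i by (simp add: C_def)
    then show ?thesis by force
  qed
  have "\<exists>n. ?a \<inter> fst ` C n \<notin> null_sets M"
  proof (rule ccontr)
    assume "\<nexists>n. ?a \<inter> fst ` C n \<notin> null_sets M"
    then have "static_points leq H \<union> (\<Union>n. ?a \<inter> fst ` C n) \<in> null_sets M"
      using static_null by (intro null_sets.Un null_sets_UN) auto
    moreover have "?a \<subseteq> static_points leq H \<union> (\<Union>n. ?a \<inter> fst ` C n)" using cover by blast
    ultimately have "?a \<in> null_sets M" by (rule null_sets_subset[OF _ initial_points_sets])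
    then show False using assms by simp
  qed
  then obtain n where n: "?a \<inter> fst ` C n \<notin> null_sets M" by blast
  have meas: "?a \<inter> fst ` C n \<in> sets M" using initial_points_sets fstC by auto
  have "\<exists>K. compact K \<and> K \<subseteq> ?a \<inter> fst ` C n \<and> emeasure M K \<noteq> 0"
  proof (rule ccontr)
    assume "\<nexists>K. compact K \<and> K \<subseteq> ?a \<inter> fst ` C n \<and> emeasure M K \<noteq> 0"
    then have "(SUP K\<in>{K. compact K \<and> K \<subseteq> ?a \<inter> fst ` C n}. emeasure M K) \<le> 0"
      by (intro SUP_least) auto
    then have "emeasure M (?a \<inter> fst ` C n) = 0"
      using radon meas by (simp add: radon_measure_on_def)
    then show False using n meas by (simp add: null_sets_def)
  qed
  then obtain K where K: "compact K" "K \<subseteq> ?a \<inter> fst ` C n" "emeasure M K \<noteq> 0" by blast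
  obtain T where T: "T \<in> borel \<rightarrow>\<^sub>M borel" "\<And>x. x \<in> fst ` C n \<Longrightarrow> (x, T x) \<in> C n"
    using compact_relation_selection[OF C] by blast
  have "T x \<in> H \<and> leq x (T x) \<and> T x \<noteq> x" if "x \<in> K" for x
  proof -
    have "(x, T x) \<in> C n" using T(2) K(2) that by blast
    moreover have "0 < 1 / (real n + 1)" by simp
    ultimately show ?thesis by (auto simp: C_def)
  qed
  then show thesis using that[of K T] K T by blast
qed

text \<open>The midpoints of an interpolation that starts in \<open>K\<close> are inner points above an initial point, so
  their pasts are bounded by \<open>bounded_past\<close>, uniformly on an event of positive probability.\<close>

lemma bounded_past_coupling:
  assumes K: "compact K" "K \<subseteq> initial_points leq H" "emeasure M K \<noteq> 0"
    and T: "T \<in> borel \<rightarrow>\<^sub>M borel" "\<And>x. x \<in> K \<Longrightarrow> T x \<in> H \<and> leq x (T x) \<and> T x \<noteq> x"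
  obtains P :: "(real \<Rightarrow> 'a) measure" and f g x0 r c where "prob_space P" "f \<in> P \<rightarrow>\<^sub>M R" "g \<in> P \<rightarrow>\<^sub>M R"
    "AE z in P. leq (f z) (g z)" "AE z in P. f z \<in> K" "AE z in P. g z \<in> inner_points leq H"
    "AE z in P. \<forall>p\<in>H. leq p (g z) \<longrightarrow> p \<in> cball x0 r"
    "c \<ge> 0" "\<And>A. A \<in> sets M \<Longrightarrow> emeasure (distr P R f) A \<le> ennreal c * emeasure M A"
proof -
  fix x0 :: 'a
  have KH: "K \<subseteq> H" using K by (auto simp: initial_points_def)
  have Kb: "K \<in> sets borel" using K by (simp add: borel_compact)
  have KM: "K \<in> sets M" using Kb KH by (simp add: sets_M sets_R_iff)
  have Kfin: "emeasure M K \<noteq> \<infinity>" using emeasure_compact_finite[OF K(1) KH] by simp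
  define \<mu> where "\<mu> = uniform_measure M K"
  interpret \<mu>: prob_space \<mu>
    unfolding \<mu>_def using K(3) Kfin by (intro prob_space_uniform_measure) auto
  have sets_\<mu>: "sets \<mu> = sets R" by (simp add: \<mu>_def sets_M)
  \<comment> \<open>Off \<open>K\<close>, which carries all the mass of \<mu>, the identity is used,
    so that \<open>g\<close> maps the whole of \<open>H\<close> into \<open>H\<close>.\<close>
  define g where "g x = (if x \<in> K then T x else x)" for x
  have id: "(\<lambda>x. x) \<in> \<mu> \<rightarrow>\<^sub>M R" using sets_\<mu> by (rule measurable_ident_sets)
  have g: "g \<in> \<mu> \<rightarrow>\<^sub>M R"
  proof -
    have "g \<in> borel_measurable borel" unfolding g_def using T(1) Kb by measurable
    then have "g \<in> R \<rightarrow>\<^sub>M R"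
      using T(2) by (intro measurable_restrict_space2 measurable_restrict_space1) (auto simp: g_def)
    then show ?thesis unfolding measurable_cong_sets[OF sets_\<mu> HOL.refl] .
  qed
  have le: "AE x in \<mu>. leq x (g x)" using T(2) refl by (auto simp: g_def)
  have AE_K: "AE x in \<mu>. x \<in> K"
    unfolding \<mu>_def by (rule AE_uniform_measureI[OF KM]) simp
  obtain \<nu> :: "(real \<Rightarrow> 'a) measure" and X where \<nu>: "prob_space \<nu>" and X: "\<And>t. t \<in> {0..1} \<Longrightarrow> X t \<in> \<nu> \<rightarrow>\<^sub>M R"
    and X0: "distr \<nu> R (X 0) = distr \<mu> R (\<lambda>x. x)" and X1: "distr \<nu> R (X 1) = distr \<mu> R g"
    and curve: "AE \<omega> in \<nu>. null_curve leq H (\<lambda>t. X t \<omega>)"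
    and "\<And>t. t \<in> {0..1} \<Longrightarrow> U_ent k (distr \<nu> R (X t)) M \<ge>
       ennreal (1 - t) * U_ent k (distr \<mu> R (\<lambda>x. x)) M + ennreal t * U_ent k (distr \<mu> R g) M"
    using interpolation[OF \<mu>.prob_space_axioms id g le] by blast
  interpret \<nu>: prob_space \<nu> by fact
  have X0m: "X 0 \<in> \<nu> \<rightarrow>\<^sub>M R" and X1m: "X 1 \<in> \<nu> \<rightarrow>\<^sub>M R" and Xhm: "X (1/2) \<in> \<nu> \<rightarrow>\<^sub>M R"
    by (rule X, simp)+
  have start: "AE \<omega> in \<nu>. X 0 \<omega> \<in> K"
  proof -
    have "{x \<in> space R. x \<in> K} = K" using KH by auto
    then have "{x \<in> space R. x \<in> K} \<in> sets R" using KM by (simp add: sets_M)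
    from AE_cong_distr[OF X0m id X0 this] AE_K show ?thesis by simp
  qed
  \<comment> \<open>As \<open>T x\<close> lies above the different point \<open>x\<close>, it is not
    initial. So the two endpoints of almost every path differ, which makes its midpoint an inner
    point.\<close>
  have finish: "AE \<omega> in \<nu>. X 1 \<omega> \<notin> K"
  proof -
    have "{x \<in> space R. x \<notin> K} = space R - K" by auto
    then have "{x \<in> space R. x \<notin> K} \<in> sets R"
      using sets.compl_sets[of K R] KM unfolding sets_M by (simp only:)
    moreover have "AE x in \<mu>. g x \<notin> K"
      using AE_K
    proof eventually_elim
      fix x assume "x \<in> K"
      then have "T x \<notin> initial_points leq H"
        using T(2)[of x] KH by (auto simp: initial_points_def)
      then show "g x \<notin> K" using K(2) \<open>x \<in> K\<close> by (auto simp: g_def)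
    qed
    ultimately show ?thesis using AE_cong_distr[OF X1m g X1, of "\<lambda>x. x \<notin> K"] by simp
  qed
  define Y where "Y n = {y \<in> H. \<forall>p\<in>H. leq p y \<longrightarrow> p \<in> cball x0 (real n)} \<inter> inner_points leq H" for n
  have YR: "Y n \<in> sets R" for n
    unfolding Y_def sets_R_iff using bounded_past_borel inner_points_borel by auto
  define S where "S n = X (1/2) -` Y n \<inter> space \<nu>" for n
  have S: "S n \<in> sets \<nu>" for n unfolding S_def using Xhm YR by (rule measurable_sets)
  have mid: "AE \<omega> in \<nu>. leq (X 0 \<omega>) (X (1/2) \<omega>) \<and> (\<exists>n. \<omega> \<in> S n)"
    using curve start finish AE_space
  proof eventually_elim
    fix \<omega> assume c: "null_curve leq H (\<lambda>t. X t \<omega>)" and s: "X 0 \<omega> \<in> K" and f: "X 1 \<omega> \<notin> K"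
      and sp: "\<omega> \<in> space \<nu>"
    have le: "leq (X 0 \<omega>) (X (1/2) \<omega>)"
      using c by (simp add: null_curve_def causal_curve_on_def)
    have "X 0 \<omega> \<noteq> X 1 \<omega>" using s f by auto
    then have inner: "X (1/2) \<omega> \<in> inner_points leq H"
      using c by (auto simp: null_curve_def)
    then have "bounded {p \<in> H. leq p (X (1/2) \<omega>)}"
      using bounded_past le s K(2) by blast
    then obtain e where "\<forall>p\<in>{p \<in> H. leq p (X (1/2) \<omega>)}. dist x0 p \<le> e"
      using bounded_any_center by blast
    then have "\<forall>p\<in>H. leq p (X (1/2) \<omega>) \<longrightarrow> p \<in> cball x0 (real (nat \<lceil>e\<rceil>))"
      by (auto intro: order_trans[OF _ real_nat_ceiling_ge])
    then have "\<omega> \<in> S (nat \<lceil>e\<rceil>)"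
      using inner sp by (auto simp: S_def Y_def inner_points_def)
    then show "leq (X 0 \<omega>) (X (1/2) \<omega>) \<and> (\<exists>n. \<omega> \<in> S n)" using le by blast
  qed
  have "\<exists>n. emeasure \<nu> (S n) \<noteq> 0"
  proof (rule ccontr)
    assume "\<nexists>n. emeasure \<nu> (S n) \<noteq> 0"
    then have "(\<Union>n. S n) \<in> null_sets \<nu>" using S by (intro null_sets_UN) (auto simp: null_sets_def)
    then have "AE \<omega> in \<nu>. \<omega> \<notin> (\<Union>n. S n)" by (rule AE_not_in)
    with mid have "AE \<omega> in \<nu>. False" by eventually_elim auto
    then show False by simp
  qed
  then obtain n where n: "emeasure \<nu> (S n) \<noteq> 0" by blast
  define P where "P = uniform_measure \<nu> (S n)"
  have P: "prob_space P" unfolding P_def using n by (intro prob_space_uniform_measure) auto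
  have sets_P: "sets P = sets \<nu>" by (simp add: P_def)
  have Pm: "X 0 \<in> P \<rightarrow>\<^sub>M R" "X (1/2) \<in> P \<rightarrow>\<^sub>M R"
    unfolding measurable_cong_sets[OF sets_P HOL.refl] by fact+
  have AE_P: "AE \<omega> in P. Q \<omega>" if "AE \<omega> in \<nu>. \<omega> \<in> S n \<longrightarrow> Q \<omega>" for Q
    unfolding P_def using S that by (rule AE_uniform_measureI)
  have in_Y: "X (1/2) \<omega> \<in> Y n" if "\<omega> \<in> S n" for \<omega> using that by (simp add: S_def)
  \<comment> \<open>The uniform measure on \<open>K\<close> has density at most
    \<open>1 / measure M K\<close>, and conditioning on \<open>S n\<close> enlarges it by at most
    the factor \<open>1 / measure \<nu> (S n)\<close>.\<close>
  define c where "c = 1 / (measure \<nu> (S n) * measure M K)"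
  have bound: "emeasure (distr P R (X 0)) A \<le> ennreal c * emeasure M A" if A: "A \<in> sets M" for A
  proof -
    have AR: "A \<in> sets R" using A by (simp add: sets_M)
    have pre: "X 0 -` A \<inter> space \<nu> \<in> sets \<nu>" using X0m AR by (rule measurable_sets)
    have spP: "space P = space \<nu>" by (simp add: P_def)
    have pos: "measure \<nu> (S n) > 0" "measure M K > 0"
      using n K(3) Kfin by (auto simp: \<nu>.emeasure_eq_measure emeasure_eq_ennreal_measure zero_less_measure_iff)
    have "emeasure (distr P R (X 0)) A = emeasure P (X 0 -` A \<inter> space \<nu>)"
      using emeasure_distr[OF Pm(1) AR] by (simp add: spP)
    also have "\<dots> = emeasure \<nu> (S n \<inter> (X 0 -` A \<inter> space \<nu>)) / emeasure \<nu> (S n)"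
      unfolding P_def using S pre by (rule emeasure_uniform_measure)
    also have "\<dots> \<le> emeasure \<nu> (X 0 -` A \<inter> space \<nu>) / emeasure \<nu> (S n)"
      using pre by (intro divide_right_mono_ennreal emeasure_mono) auto
    also have "emeasure \<nu> (X 0 -` A \<inter> space \<nu>) = emeasure (distr \<nu> R (X 0)) A"
      using emeasure_distr[OF X0m AR] by simp
    also have "\<dots> = emeasure \<mu> (A \<inter> space \<mu>)"
      unfolding X0 using emeasure_distr[OF id AR] by simp
    also have "A \<inter> space \<mu> = A" using sets.sets_into_space[OF A] by (auto simp: \<mu>_def)
    also have "emeasure \<mu> A = emeasure M (K \<inter> A) / emeasure M K"
      unfolding \<mu>_def using KM A by (rule emeasure_uniform_measure)
    also have "\<dots> / emeasure \<nu> (S n) \<le> emeasure M A / emeasure M K / emeasure \<nu> (S n)"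
      using A by (intro divide_right_mono_ennreal emeasure_mono) auto
    also have "\<dots> = ennreal c * emeasure M A"
    proof -
      have "emeasure M K = ennreal (measure M K)" using Kfin by (simp add: emeasure_eq_ennreal_measure)
      then have "emeasure M A / emeasure M K / emeasure \<nu> (S n) =
          emeasure M A * (ennreal (1 / measure M K) * ennreal (1 / measure \<nu> (S n)))"
        using pos by (simp add: \<nu>.emeasure_eq_measure divide_ennreal_def inverse_ennreal mult.assoc inverse_eq_divide)
      also have "\<dots> = emeasure M A * ennreal c"
        using pos by (simp add: c_def mult.commute flip: ennreal_mult)
      finally show ?thesis by (simp add: mult.commute)
    qed
    finally show ?thesis .
  qed
  show thesis
  proof (rule that[OF P Pm])
    show "AE z in P. leq (X 0 z) (X (1/2) z)"
      by (rule AE_P) (use mid in \<open>eventually_elim, simp\<close>)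
    show "AE z in P. X 0 z \<in> K"
      by (rule AE_P) (use start in \<open>eventually_elim, simp\<close>)
    show "AE z in P. X (1/2) z \<in> inner_points leq H"
      by (rule AE_P) (use in_Y in \<open>auto simp: Y_def\<close>)
    show "AE z in P. \<forall>p\<in>H. leq p (X (1/2) z) \<longrightarrow> p \<in> cball x0 (real n)"
      by (rule AE_P) (use in_Y in \<open>auto simp: Y_def\<close>)
    show "c \<ge> 0" by (simp add: c_def)
  qed (rule bound)
qed

lemma initial_points_null: "initial_points leq H \<in> null_sets M"
proof (rule ccontr)
  assume "initial_points leq H \<notin> null_sets M"
  then obtain K and T :: "'a \<Rightarrow> 'a" where K: "compact K" "K \<subseteq> initial_points leq H" "emeasure M K \<noteq> 0"
    and T: "T \<in> borel \<rightarrow>\<^sub>M borel" "\<And>x. x \<in> K \<Longrightarrow> T x \<in> H \<and> leq x (T x) \<and> T x \<noteq> x"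
    using compact_positive_initial_points by blast
  obtain P :: "(real \<Rightarrow> 'a) measure" and f g x0 r c where P: "prob_space P" "f \<in> P \<rightarrow>\<^sub>M R" "g \<in> P \<rightarrow>\<^sub>M R"
    "AE z in P. leq (f z) (g z)" and fK: "AE z in P. f z \<in> K" and g_inner: "AE z in P. g z \<in> inner_points leq H"
    and past: "AE z in P. \<forall>p\<in>H. leq p (g z) \<longrightarrow> p \<in> cball x0 r"
    and c: "c \<ge> 0" "\<And>A. A \<in> sets M \<Longrightarrow> emeasure (distr P R f) A \<le> ennreal c * emeasure M A"
    using bounded_past_coupling[OF K T] by blast
  obtain \<nu> :: "(real \<Rightarrow> 'a) measure" and X where \<nu>: "prob_space \<nu>" and X: "\<And>t. t \<in> {0..1} \<Longrightarrow> X t \<in> \<nu> \<rightarrow>\<^sub>M R"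
    and X0: "distr \<nu> R (X 0) = distr P R f" and X1: "distr \<nu> R (X 1) = distr P R g"
    and curve: "AE \<omega> in \<nu>. null_curve leq H (\<lambda>t. X t \<omega>)"
    and U: "\<And>t. t \<in> {0..1} \<Longrightarrow> U_ent k (distr \<nu> R (X t)) M \<ge>
       ennreal (1 - t) * U_ent k (distr P R f) M + ennreal t * U_ent k (distr P R g) M"
    using interpolation[OF P] by blast
  have X0m: "X 0 \<in> \<nu> \<rightarrow>\<^sub>M R" and X1m: "X 1 \<in> \<nu> \<rightarrow>\<^sub>M R"
    by (rule X, simp)+
  interpret sigma_finite_measure M
    using radon proper closed_H by (rule radon_measure_on_sigma_finite)
  have "Ent (distr P R f) M < \<infinity>"
    using c P by (intro Ent_less_PInfty_if_le prob_space.prob_space_distr) (auto simp: sets_M)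
  then have "U_ent k (distr P R f) M > 0" by (simp add: U_ent_pos_iff)
  then have "ennreal (1/2) * U_ent k (distr P R f) M > 0"
    unfolding ennreal_zero_less_mult_iff by (simp only: ennreal_less_zero_iff) simp
  then obtain u where u: "u > 0" "ennreal u \<le> ennreal (1/2) * U_ent k (distr P R f) M"
    using that[of 1] by (cases "ennreal (1/2) * U_ent k (distr P R f) M") (auto simp: ennreal_less_zero_iff)
  have E: "Ent (distr \<nu> R (X t)) M \<le> ereal (- k * ln u)" if t: "t \<in> {0<..<1/2}" for t
  proof (rule Ent_le_if_U_ent_ge)
    note u(2)
    also have "ennreal (1/2) * U_ent k (distr P R f) M \<le> ennreal (1 - t) * U_ent k (distr P R f) M"
      using t by (intro mult_right_mono ennreal_leI) auto
    also have "\<dots> \<le> ennreal (1 - t) * U_ent k (distr P R f) M + ennreal t * U_ent k (distr P R g) M" by simp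
    also have "\<dots> \<le> U_ent k (distr \<nu> R (X t)) M" using t by (intro U) auto
    finally show "ennreal u \<le> U_ent k (distr \<nu> R (X t)) M" .
  qed (fact u k_pos)+
  let ?B = "cball x0 r \<inter> H"
  \<comment> \<open>Both properties of the endpoint are used. As its past lies in the ball, the
    whole path does; as it is an inner point, it is not in \<open>K\<close>, so the path is not
    constant and runs through inner points at all times strictly between 0 and 1.\<close>
  define Y where "Y = {y \<in> H. \<forall>p\<in>H. leq p y \<longrightarrow> p \<in> cball x0 r} \<inter> inner_points leq H"
  have KH: "K \<subseteq> H" using K by (auto simp: initial_points_def)
  have start: "AE \<omega> in \<nu>. X 0 \<omega> \<in> K"
  proof -
    have "{x \<in> space R. x \<in> K} = K" using KH by auto
    then have "{x \<in> space R. x \<in> K} \<in> sets R" using K KH by (simp add: sets_R_iff borel_compact)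
    from AE_cong_distr[OF X0m P(2) X0 this] fK show ?thesis by simp
  qed
  have finish: "AE \<omega> in \<nu>. X 1 \<omega> \<in> Y"
  proof -
    have "{x \<in> space R. x \<in> Y} = Y" by (auto simp: Y_def)
    moreover have "Y \<in> sets R"
      unfolding Y_def sets_R_iff using bounded_past_borel inner_points_borel by auto
    moreover have "AE z in P. g z \<in> Y"
      using g_inner past by eventually_elim (auto simp: Y_def inner_points_def)
    ultimately show ?thesis using AE_cong_distr[OF X1m P(3) X1, of "\<lambda>x. x \<in> Y"] by simp
  qed
  have "\<exists>t\<in>{0<..<1/2}. Ent (distr \<nu> R (X t)) M > ereal (- k * ln u)"
  proof (rule Ent_blow_up[OF \<nu> X K(1)])
    show "compact ?B" "?B \<subseteq> H" using proper closed_H by (auto intro: compact_Int_closed)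
    show "AE \<omega> in \<nu>. continuous_on {0..1} (\<lambda>t. X t \<omega>)"
      using curve by eventually_elim (simp add: null_curve_def causal_curve_on_def)
    show "AE \<omega> in \<nu>. \<forall>t\<in>{0<..<1}. X t \<omega> \<in> ?B - K"
      using curve start finish
    proof eventually_elim
      fix \<omega> assume cv: "null_curve leq H (\<lambda>t. X t \<omega>)" and s: "X 0 \<omega> \<in> K" and f: "X 1 \<omega> \<in> Y"
      have off: "x \<notin> K" if "x \<in> inner_points leq H" for x
        using that K(2) by (auto simp: inner_points_def)
      have ne: "X 0 \<omega> \<noteq> X 1 \<omega>" using s f off by (auto simp: Y_def)
      show "\<forall>t\<in>{0<..<1}. X t \<omega> \<in> ?B - K"
      proof
        fix t :: real assume t: "t \<in> {0<..<1}"
        then have inner: "X t \<omega> \<in> inner_points leq H"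
          using cv ne by (auto simp: null_curve_def)
        moreover have "leq (X t \<omega>) (X 1 \<omega>)"
          using cv t by (auto simp: null_curve_def causal_curve_on_def)
        ultimately show "X t \<omega> \<in> ?B - K"
          using f off by (auto simp: Y_def inner_points_def)
      qed
    qed
  qed (use start in simp_all)
  then show False using E by (meson not_le)
qed

end

section \<open>Both time directions combined\<close>

theorem theorem5p13:
  fixes chron leq :: "'a::polish_space \<Rightarrow> 'a \<Rightarrow> bool"
    and H :: "'a set" and G :: "'a \<Rightarrow> real" and \<mm> :: "'a measure" and N :: real
  assumes "topological_causal_space chron leq"
    and "synthetic_null_hypersurface chron leq H G \<mm>"
    and "null_nonbranching leq H"
    and "N > 1"
    and "NCe leq H G \<mm> N"
  shows "initial_points leq H \<in> null_sets \<mm> \<and> final_points leq H \<in> null_sets \<mm>"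
proof -
  interpret X: topological_causal_space chron leq by fact
  have refl: "leq x x" for x using X.leq_refl by (rule reflpD)
  have H: "closed H" and G: "null_gauge leq H G" and radon: "radon_measure_on H \<mm>"
    and static: "static_points leq H \<in> null_sets \<mm>"
    using assms(2) by (auto simp: synthetic_null_hypersurface_def)
  interpret F: null_flow leq H \<mm> "N - 1"
  proof
    show "leq x z" if "leq x y" "leq y z" for x y z using X.leq_trans that by (rule transpD)
    show "null_interpolation leq H \<mm> (N - 1)"
      using refl X.closed_leq H assms(5) by (rule NCe_imp_null_interpolation)
  qed (use refl X.closed_leq X.proper H radon static assms(4) in auto)
  note antisym = F.gauge_imp_antisym[OF G]
  interpret F: nonbranching_null_flow leq H \<mm> "N - 1"
    using antisym assms(3) by unfold_locales (auto simp: null_nonbranching_def)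
  interpret C: null_flow "\<lambda>x y. leq y x" H \<mm> "N - 1" by (rule F.converse)
  \<comment> \<open>Reversing twice, backward non-branching for the reversed order is forward
    non-branching for \<open>leq\<close>.\<close>
  interpret C: nonbranching_null_flow "\<lambda>x y. leq y x" H \<mm> "N - 1"
    using antisym assms(3)
    by unfold_locales (auto simp: null_nonbranching_def backward_null_nonbranching_def)
  show ?thesis
    using F.initial_points_null C.initial_points_null unfolding initial_points_converse by blast
qed

end
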